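(* Let $0\le m\le n$ be integers. For any family of forests $\{F_\pi\}_{\pi\in\Pi_{n,m}}$ on the vertex set $[n]$ with $\tilde{\pi}(F_\pi)=\pi$ for all $\pi\in\Pi_{n,m}$, the family of monomials $\{\mathfrak{m}(F_\pi):\pi\in\Pi_{n,m}\}$ descends to a basis of $R(\Pi_{n,m})$. Furthermore, we have $$\mathrm{gr}\,\mathbf{I}(\Pi_{n,m})=I_{n,m}.$$
   Context: Let $[n]=\{1,\dots,n\}$ and let $\binom{[n]}{2}$ be the set of 2-element subsets of $[n]$. Let $\mathbb{C}\big[\mathbf{x}_{\binom{[n]}{2}}\big]$ be the polynomial ring in the variables $x_{\{i,j\}}=x_{\{j,i\}}$ indexed by $\binom{[n]}{2}$; it is the coordinate ring of $\mathbb{C}^{\binom{[n]}{2}}$. An unordered set partition $\pi$ of $[n]$ is identified with the point $\mathbf{z}\in\mathbb{C}^{\binom{[n]}{2}}$ with $z_{\{i,j\}}=1$ if $i,j$ lie in the same block of $\pi$, and $z_{\{i,j\}}=0$ otherwise. $\Pi_{n,m}\subseteq\mathbb{C}^{\binom{[n]}{2}}$ is the finite set of (points identified with) unordered set partitions of $[n]$ all of whose blocks have size at most $m$. For a finite set $\mathcal{Z}\subseteq\mathbb{C}^{\binom{[n]}{2}}$, $\mathbf{I}(\mathcal{Z})$ is the ideal of polynomials vanishing on $\mathcal{Z}$; for a nonzero polynomial $f$, $\tau(f)$ is its top-degree homogeneous component; $\mathrm{gr}\,\mathbf{I}(\mathcal{Z})=\langle\tau(f): 0\ne f\in\mathbf{I}(\mathcal{Z})\rangle$;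 and $R(\mathcal{Z})=\mathbb{C}\big[\mathbf{x}_{\binom{[n]}{2}}\big]/\mathrm{gr}\,\mathbf{I}(\mathcal{Z})$. For a simple graph $G$ with vertices in $[n]$ and edge set $E(G)\subseteq\binom{[n]}{2}$, the graph monomial is $\mathfrak{m}(G)=\prod_{S\in E(G)}x_S$. For a forest $F$ on the vertex set $[n]$, $\tilde{\pi}(F)$ is the unordered set partition of $[n]$ whose blocks are the vertex sets of the connected components of $F$. The ideal $I_{n,m}\subseteq\mathbb{C}\big[\mathbf{x}_{\binom{[n]}{2}}\big]$ is generated by all squares $x_S^2$ for $S\in\binom{[n]}{2}$; all differences $x_{\{i,j\}}x_{\{j,k\}}-x_{\{i,k\}}x_{\{j,k\}}$ for pairwise distinct $i,j,k\in[n]$; and all monomials $\mathfrak{m}(T)$ for trees $T$ with $m+1$ vertices in $[n]$. *)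

theory Defs
  imports Complex_Main "HOL-Library.Poly_Mapping" "HOL-Library.Disjoint_Sets"
    "HOL-Algebra.QuotRing" "HOL-Algebra.Module"
begin

definition pairs :: "'a set \<Rightarrow> 'a set set" where
  "pairs V = {S. S \<subseteq> V \<and> card S = 2}"

section \<open>Polynomials in the variables indexed by 2-element subsets\<close>

text \<open>A monomial is a finitely supported map from variable names to exponents.  The type
  admits every set of naturals as a variable name; \<open>poly_ring n\<close> below restricts to the
  variables indexed by the 2-element subsets of \<open>{1..n}\<close>.\<close>

type_synonym mon = "nat set \<Rightarrow>\<^sub>0 nat"
type_synonym mpoly = "mon \<Rightarrow>\<^sub>0 complex"

definition var :: "nat set \<Rightarrow> mpoly" where
  "var S = Poly_Mapping.single (Poly_Mapping.single S 1) 1"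

definition const :: "complex \<Rightarrow> mpoly" where
  "const c = Poly_Mapping.single 0 c"

definition poly_ring :: "nat \<Rightarrow> mpoly ring" where
  "poly_ring n =
    \<lparr>carrier = {f. \<forall>t\<in>Poly_Mapping.keys f. Poly_Mapping.keys t \<subseteq> pairs {1..n}},
     mult = (*), one = 1, zero = 0, add = (+)\<rparr>"

definition eval_mpoly :: "(nat set \<Rightarrow> complex) \<Rightarrow> mpoly \<Rightarrow> complex" where
  "eval_mpoly z f =
    (\<Sum>t\<in>Poly_Mapping.keys f. Poly_Mapping.lookup f t *
      (\<Prod>S\<in>Poly_Mapping.keys t. z S ^ Poly_Mapping.lookup t S))"

definition mon_degree :: "mon \<Rightarrow> nat" where
  "mon_degree t = (\<Sum>S\<in>Poly_Mapping.keys t. Poly_Mapping.lookup t S)"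

text \<open>Only meaningful for nonzero polynomials.\<close>

definition total_degree :: "mpoly \<Rightarrow> nat" where
  "total_degree f = Max (mon_degree ` Poly_Mapping.keys f)"

definition top_component :: "mpoly \<Rightarrow> mpoly" where
  "top_component f =
    (\<Sum>t\<in>{t \<in> Poly_Mapping.keys f. mon_degree t = total_degree f}.
      Poly_Mapping.single t (Poly_Mapping.lookup f t))"

section \<open>The orbit harmonics quotient of a set of points\<close>

text \<open>A point is a function on \<open>pairs {1..n}\<close>; its values elsewhere are
  irrelevant to the evaluation of members of \<open>poly_ring n\<close>.\<close>

definition vanishing_ideal :: "nat \<Rightarrow> (nat set \<Rightarrow> complex) set \<Rightarrow> mpoly set" where
  "vanishing_ideal n Z = {f \<in> carrier (poly_ring n). \<forall>z\<in>Z. eval_mpoly z f = 0}"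

definition gr_ideal :: "nat \<Rightarrow> mpoly set \<Rightarrow> mpoly set" where
  "gr_ideal n I = Idl\<^bsub>poly_ring n\<^esub> {top_component f | f. f \<in> I \<and> f \<noteq> 0}"

text \<open>The quotient ring of \<open>poly_ring n\<close> by \<open>I\<close>, with scalars acting through the
  classes of the constant polynomials.\<close>

definition quotient_algebra :: "nat \<Rightarrow> mpoly set \<Rightarrow> (complex, mpoly set) module" where
  "quotient_algebra n I =
    ring.extend (poly_ring n Quot I)
      \<lparr>smult = (\<lambda>c X. (I +>\<^bsub>poly_ring n\<^esub> const c) \<otimes>\<^bsub>poly_ring n Quot I\<^esub> X)\<rparr>"

definition coset :: "nat \<Rightarrow> mpoly set \<Rightarrow> mpoly \<Rightarrow> mpoly set" where
  "coset n I f = I +>\<^bsub>poly_ring n\<^esub> f"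

definition orbit_harmonics :: "nat \<Rightarrow> (nat set \<Rightarrow> complex) set \<Rightarrow> (complex, mpoly set) module" where
  "orbit_harmonics n Z = quotient_algebra n (gr_ideal n (vanishing_ideal n Z))"

text \<open>Bases are indexed families: linear independence forbids repetitions.\<close>

definition lin_indep_family ::
    "(complex, 'b) module \<Rightarrow> 'i set \<Rightarrow> ('i \<Rightarrow> 'b) \<Rightarrow> bool" where
  "lin_indep_family M A b \<longleftrightarrow>
    (\<forall>c. (\<Oplus>\<^bsub>M\<^esub>i\<in>A. c i \<odot>\<^bsub>M\<^esub> b i) = \<zero>\<^bsub>M\<^esub> \<longrightarrow> (\<forall>i\<in>A. c i = 0))"

definition spanning_family ::
    "(complex, 'b) module \<Rightarrow> 'i set \<Rightarrow> ('i \<Rightarrow> 'b) \<Rightarrow> bool" where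
  "spanning_family M A b \<longleftrightarrow>
    (\<forall>v\<in>carrier M. \<exists>c. v = (\<Oplus>\<^bsub>M\<^esub>i\<in>A. c i \<odot>\<^bsub>M\<^esub> b i))"

definition finite_basis_family ::
    "(complex, 'b) module \<Rightarrow> 'i set \<Rightarrow> ('i \<Rightarrow> 'b) \<Rightarrow> bool" where
  "finite_basis_family M A b \<longleftrightarrow>
    finite A \<and> b \<in> A \<rightarrow> carrier M \<and> lin_indep_family M A b \<and> spanning_family M A b"

section \<open>Set partitions as points\<close>

definition set_partitions :: "nat \<Rightarrow> nat \<Rightarrow> nat set set set" where
  "set_partitions n m = {\<pi>. partition_on {1..n} \<pi> \<and> (\<forall>B\<in>\<pi>. card B \<le> m)}"

definition partition_point :: "nat \<Rightarrow> nat set set \<Rightarrow> nat set \<Rightarrow> complex" where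
  "partition_point n \<pi> = (\<lambda>S\<in>pairs {1..n}. if \<exists>B\<in>\<pi>. S \<subseteq> B then 1 else 0)"

definition partition_locus :: "nat \<Rightarrow> nat \<Rightarrow> (nat set \<Rightarrow> complex) set" where
  "partition_locus n m = partition_point n ` set_partitions n m"

section \<open>Simple graphs\<close>

text \<open>A simple graph is given by its vertex set \<open>V\<close> and its set \<open>E\<close> of 2-element edges.\<close>

definition simple_graph :: "'a set \<Rightarrow> 'a set set \<Rightarrow> bool" where
  "simple_graph V E \<longleftrightarrow> finite V \<and> E \<subseteq> pairs V"

definition connection :: "'a set \<Rightarrow> 'a set set \<Rightarrow> ('a \<times> 'a) set" where
  "connection V E = {(u, v). u \<in> V \<and> v \<in> V \<and> (u, v) \<in> {(x, y). {x, y} \<in> E}\<^sup>*}"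

definition components :: "'a set \<Rightarrow> 'a set set \<Rightarrow> 'a set set" where
  "components V E = V // connection V E"

definition connected_graph :: "'a set \<Rightarrow> 'a set set \<Rightarrow> bool" where
  "connected_graph V E \<longleftrightarrow> V \<noteq> {} \<and> (\<forall>u\<in>V. \<forall>v\<in>V. (u, v) \<in> connection V E)"

definition is_cycle :: "'a set set \<Rightarrow> 'a list \<Rightarrow> bool" where
  "is_cycle E vs \<longleftrightarrow> length vs \<ge> 3 \<and> distinct vs \<and>
    (\<forall>i<length vs. {vs ! i, vs ! (Suc i mod length vs)} \<in> E)"

definition forest :: "'a set \<Rightarrow> 'a set set \<Rightarrow> bool" where
  "forest V E \<longleftrightarrow> simple_graph V E \<and> (\<nexists>vs. is_cycle E vs)"

definition tree :: "'a set \<Rightarrow> 'a set set \<Rightarrow> bool" where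
  "tree V E \<longleftrightarrow> forest V E \<and> connected_graph V E"

definition graph_monomial :: "nat set set \<Rightarrow> mpoly" where
  "graph_monomial E = (\<Prod>S\<in>E. var S)"

section \<open>The ideal given by explicit generators\<close>

definition I_ideal :: "nat \<Rightarrow> nat \<Rightarrow> mpoly set" where
  "I_ideal n m = Idl\<^bsub>poly_ring n\<^esub>
    ({var S ^ 2 | S. S \<in> pairs {1..n}}
     \<union> {var {i, j} * var {j, k} - var {i, k} * var {j, k} | i j k.
          {i, j, k} \<subseteq> {1..n} \<and> i \<noteq> j \<and> j \<noteq> k \<and> i \<noteq> k}
     \<union> {graph_monomial E | V E. V \<subseteq> {1..n} \<and> card V = m + 1 \<and> tree V E})"

end

theory Submission
  imports Defs
begin

text \<open>
  Write \<open>I\<close> for \<open>I_ideal n m\<close> and \<open>gr\<close> for the associated graded ideal of the locus of partitions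
  with blocks of size at most \<open>m\<close>.  Everything follows from three facts about the monomials of the
  chosen forests.

  First, \<open>I \<subseteq> gr\<close> (\<open>I_ideal_subset_gr_ideal\<close>), because each generator of \<open>I\<close> is the top
  component of a polynomial that vanishes on the locus: \<open>x\<^sup>2 - x\<close>, a difference of two equal
  indicators, or a product that indicates a block with more than \<open>m\<close> elements.

  Secondly, the forest monomials span the polynomial ring modulo \<open>I\<close>
  (\<open>forest_monomials_span_mod_I_ideal\<close>).  To every equivalence relation belongs a star monomial, in
  which each element is joined to the minimum of its class.  Modulo \<open>I\<close>, multiplying a star monomial
  by a variable \<open>x\<close> gives zero if the two ends of \<open>x\<close> are equivalent and otherwise the star monomial
  of the relation in which their classes are fused.  Hence every monomial reduces to zero or to a
  star monomial, the latter is in \<open>I\<close> if a class has more than \<open>m\<close> elements, and the monomial of a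
  forest reduces to the star monomial of its components.

  Thirdly, the forest monomials are linearly independent modulo \<open>gr\<close>
  (\<open>forest_monomials_independent_mod_gr_ideal\<close>).  For a partition \<open>\<rho>\<close> in the locus, add up the
  coefficients of the monomials whose degree is the rank of \<open>\<rho>\<close> and whose edges have the components
  \<open>\<rho>\<close>.  This functional vanishes on \<open>gr\<close>: as functions on the locus, monomials with the same
  components coincide, and different components give functions that are unitriangular with respect
  to refinement; moreover, a monomial of degree below the rank of \<open>\<rho>\<close> has too few edges to have
  components \<open>\<rho>\<close>.  On the forest monomials these functionals form a dual family.

  By the first two facts the forest monomials span modulo \<open>gr\<close>, so they give a basis.  An element of
  \<open>gr\<close> is congruent modulo \<open>I\<close> to a combination of forest monomials, whose coefficients
  vanish by independence; so \<open>gr \<subseteq> I\<close>.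
\<close>

section \<open>Polynomials and linear functionals\<close>

text \<open>Every functional needed below, evaluation at a point included, is determined by its
  values \<open>w t\<close> on monomials.  Such a functional is insensitive to how a polynomial is
  written, and products only shift the argument of \<open>w\<close>.\<close>

definition lin_ext :: "(mon \<Rightarrow> complex) \<Rightarrow> mpoly \<Rightarrow> complex" where
  "lin_ext w f = (\<Sum>t\<in>Poly_Mapping.keys f. Poly_Mapping.lookup f t * w t)"

lemma lin_ext_superset:
  assumes "finite A" "Poly_Mapping.keys f \<subseteq> A"
  shows "lin_ext w f = (\<Sum>t\<in>A. Poly_Mapping.lookup f t * w t)"
  unfolding lin_ext_def using assms
  by (intro sum.mono_neutral_left) (auto simp: in_keys_iff)

lemma lin_ext_add: "lin_ext w (f + g) = lin_ext w f + lin_ext w g"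
proof -
  let ?A = "Poly_Mapping.keys f \<union> Poly_Mapping.keys g"
  have "Poly_Mapping.keys (f + g) \<subseteq> ?A" by (rule keys_add)
  then show ?thesis
    by (simp add: lin_ext_superset[of ?A] lookup_add distrib_right sum.distrib)
qed

lemma lin_ext_zero [simp]: "lin_ext w 0 = 0"
  by (simp add: lin_ext_def)

lemma lin_ext_uminus: "lin_ext w (- f) = - lin_ext w f"
  using lin_ext_add[of w f "- f"] by (simp add: eq_neg_iff_add_eq_0 add.commute)

lemma lin_ext_diff: "lin_ext w (f - g) = lin_ext w f - lin_ext w g"
  using lin_ext_add[of w f "- g"] by (simp add: lin_ext_uminus)

lemma lin_ext_sum: "lin_ext w (sum f A) = (\<Sum>i\<in>A. lin_ext w (f i))"
  by (induction A rule: infinite_finite_induct) (auto simp: lin_ext_add)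

lemma lin_ext_single [simp]: "lin_ext w (Poly_Mapping.single t c) = c * w t"
  by (simp add: lin_ext_def)

lemma lin_ext_scale: "lin_ext (\<lambda>t. a * w t) f = a * lin_ext w f"
  by (simp add: lin_ext_def sum_distrib_left mult.left_commute)

lemma lin_ext_cong:
  "(\<And>t. t \<in> Poly_Mapping.keys f \<Longrightarrow> w t = w' t) \<Longrightarrow> lin_ext w f = lin_ext w' f"
  unfolding lin_ext_def by (intro sum.cong) auto

lemma sum_of_terms:
  "f = (\<Sum>t\<in>Poly_Mapping.keys f. Poly_Mapping.single t (Poly_Mapping.lookup f t))"
  by (rule poly_mapping_eqI)
     (auto simp: lookup_sum lookup_single when_def in_keys_iff)

lemma lin_ext_single_mult:
  "lin_ext w (Poly_Mapping.single h c * f) = c * lin_ext (\<lambda>t. w (h + t)) f"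
proof -
  have "Poly_Mapping.single h c * f =
      (\<Sum>t\<in>Poly_Mapping.keys f. Poly_Mapping.single (h + t) (c * Poly_Mapping.lookup f t))"
    by (subst sum_of_terms[of f]) (simp add: sum_distrib_left mult_single)
  then show ?thesis
    by (simp add: lin_ext_sum lin_ext_def[of _ f] sum_distrib_left mult.assoc)
qed

lemma lin_ext_mult:
  "lin_ext w (f * g) = lin_ext (\<lambda>s. lin_ext (\<lambda>t. w (s + t)) g) f"
  by (subst sum_of_terms[of f])
     (simp add: sum_distrib_right lin_ext_sum lin_ext_single_mult lin_ext_def[of _ f])

definition mon_val :: "(nat set \<Rightarrow> complex) \<Rightarrow> mon \<Rightarrow> complex" where
  "mon_val z t = (\<Prod>S\<in>Poly_Mapping.keys t. z S ^ Poly_Mapping.lookup t S)"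

lemma eval_mpoly_lin_ext: "eval_mpoly z f = lin_ext (mon_val z) f"
  by (simp add: eval_mpoly_def lin_ext_def mon_val_def)

lemma keys_add_mon [simp]:
  "Poly_Mapping.keys (s + t :: mon) = Poly_Mapping.keys s \<union> Poly_Mapping.keys t"
  by (auto simp: in_keys_iff lookup_add)

lemma mon_val_add: "mon_val z (s + t) = mon_val z s * mon_val z t"
proof -
  let ?A = "Poly_Mapping.keys s \<union> Poly_Mapping.keys t"
  have *: "mon_val z u = (\<Prod>S\<in>?A. z S ^ Poly_Mapping.lookup u S)"
    if "Poly_Mapping.keys u \<subseteq> ?A" for u
    unfolding mon_val_def using that
    by (intro prod.mono_neutral_left) (auto simp: in_keys_iff)
  show ?thesis by (simp add: * lookup_add power_add prod.distrib)
qed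

lemma mon_degree_add: "mon_degree (s + t) = mon_degree s + mon_degree t"
proof -
  let ?A = "Poly_Mapping.keys s \<union> Poly_Mapping.keys t"
  have *: "mon_degree u = (\<Sum>S\<in>?A. Poly_Mapping.lookup u S)"
    if "Poly_Mapping.keys u \<subseteq> ?A" for u
    unfolding mon_degree_def using that
    by (intro sum.mono_neutral_left) (auto simp: in_keys_iff)
  show ?thesis by (simp add: * lookup_add sum.distrib)
qed

lemma card_keys_le_mon_degree: "card (Poly_Mapping.keys t) \<le> mon_degree t"
proof -
  have "(\<Sum>S\<in>Poly_Mapping.keys t. 1) \<le> (\<Sum>S\<in>Poly_Mapping.keys t. Poly_Mapping.lookup t S)"
    by (rule sum_mono) (use in_keys_iff[of _ t] in fastforce)
  then show ?thesis by (simp add: mon_degree_def)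
qed

definition edge_mon :: "nat set set \<Rightarrow> mon" where
  "edge_mon E = (\<Sum>S\<in>E. Poly_Mapping.single S 1)"

lemma graph_monomial_edge_mon: "graph_monomial E = Poly_Mapping.single (edge_mon E) 1"
  by (induction E rule: infinite_finite_induct)
     (simp_all add: graph_monomial_def edge_mon_def var_def mult_single)

lemma lookup_edge_mon: "finite E \<Longrightarrow> Poly_Mapping.lookup (edge_mon E) S = (if S \<in> E then 1 else 0)"
  by (simp add: edge_mon_def lookup_sum lookup_single when_def)

lemma keys_edge_mon: "finite E \<Longrightarrow> Poly_Mapping.keys (edge_mon E) = E"
  by (auto simp: in_keys_iff lookup_edge_mon split: if_splits)

lemma mon_degree_edge_mon: "finite E \<Longrightarrow> mon_degree (edge_mon E) = card E"
  by (simp add: mon_degree_def keys_edge_mon lookup_edge_mon)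

section \<open>The polynomial ring and its ideals\<close>

definition mons :: "nat \<Rightarrow> mon set" where
  "mons n = {t. Poly_Mapping.keys t \<subseteq> pairs {1..n}}"

abbreviation polys :: "nat \<Rightarrow> mpoly set" where
  "polys n \<equiv> carrier (poly_ring n)"

lemma polys_iff: "f \<in> polys n \<longleftrightarrow> Poly_Mapping.keys f \<subseteq> mons n"
  by (auto simp: poly_ring_def mons_def)

lemma zero_mons [simp]: "0 \<in> mons n"
  by (simp add: mons_def)

lemma add_mons [simp]: "s + t \<in> mons n \<longleftrightarrow> s \<in> mons n \<and> t \<in> mons n"
  by (auto simp: mons_def)

lemma polys_constants [simp]: "0 \<in> polys n" "1 \<in> polys n" "const c \<in> polys n"
  by (simp_all add: polys_iff const_def)

lemma polys_add [simp]: "f \<in> polys n \<Longrightarrow> g \<in> polys n \<Longrightarrow> f + g \<in> polys n"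
  using keys_add[of f g] unfolding polys_iff by blast

lemma polys_mult [simp]: "f \<in> polys n \<Longrightarrow> g \<in> polys n \<Longrightarrow> f * g \<in> polys n"
  using keys_mult[of f g] unfolding polys_iff by force

lemma polys_uminus [simp]: "f \<in> polys n \<Longrightarrow> - f \<in> polys n"
  by (simp add: polys_iff in_keys_iff subset_iff)

lemma polys_diff [simp]: "f \<in> polys n \<Longrightarrow> g \<in> polys n \<Longrightarrow> f - g \<in> polys n"
  using polys_add[of f n "- g"] polys_uminus by simp

lemma polys_sum [simp]: "(\<And>i. i \<in> A \<Longrightarrow> f i \<in> polys n) \<Longrightarrow> sum f A \<in> polys n"
  by (induction A rule: infinite_finite_induct) auto

lemma polys_prod [simp]: "(\<And>i. i \<in> A \<Longrightarrow> f i \<in> polys n) \<Longrightarrow> prod f A \<in> polys n"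
  by (induction A rule: infinite_finite_induct) auto

lemma var_polys [simp]: "S \<in> pairs {1..n} \<Longrightarrow> var S \<in> polys n"
  by (simp add: var_def polys_iff mons_def)

lemma graph_monomial_polys [simp]: "E \<subseteq> pairs {1..n} \<Longrightarrow> graph_monomial E \<in> polys n"
  unfolding graph_monomial_def by (rule polys_prod) auto

lemma poly_ring_simps [simp]:
  "mult (poly_ring n) = (*)" "one (poly_ring n) = 1"
  "zero (poly_ring n) = 0" "add (poly_ring n) = (+)"
  by (simp_all add: poly_ring_def)

lemma cring_poly_ring: "cring (poly_ring n)"
proof (rule cringI)
  show "abelian_group (poly_ring n)"
  proof (rule abelian_groupI)
    fix x assume "x \<in> polys n"
    then show "\<exists>y\<in>polys n. y \<oplus>\<^bsub>poly_ring n\<^esub> x = \<zero>\<^bsub>poly_ring n\<^esub>"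
      by (intro bexI[of _ "- x"]) auto
  qed (auto simp: add_ac)
  show "Group.comm_monoid (poly_ring n)"
    by (rule comm_monoidI) (auto simp: mult_ac)
qed (auto simp: distrib_right)

lemma ideal_poly_ringI:
  assumes "I \<subseteq> polys n" "0 \<in> I" "\<And>f g. f \<in> I \<Longrightarrow> g \<in> I \<Longrightarrow> f + g \<in> I"
    "\<And>f r. f \<in> I \<Longrightarrow> r \<in> polys n \<Longrightarrow> r * f \<in> I"
  shows "ideal I (poly_ring n)"
proof (rule idealI)
  interpret cring "poly_ring n" by (rule cring_poly_ring)
  show "ring (poly_ring n)" by (rule ring_axioms)
  have inv: "\<ominus>\<^bsub>poly_ring n\<^esub> a = - a" if "a \<in> polys n" for a
    using that minus_equality[of "- a" a] by simp
  have neg: "- a \<in> I" if "a \<in> I" for a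
    using assms(4)[OF that, of "- 1"] by simp
  show "subgroup I (add_monoid (poly_ring n))"
    by (rule add.subgroupI)
       (use assms inv neg in \<open>auto simp: subset_iff simp flip: a_inv_def\<close>)
qed (use assms in \<open>auto simp: mult.commute\<close>)

context
  fixes I n assumes I: "ideal I (poly_ring n)"
begin

interpretation ideal I "poly_ring n" by (rule I)

lemma ideal_sub: "I \<subseteq> polys n"
  using a_subset by simp

lemma ideal_polys: "f \<in> I \<Longrightarrow> f \<in> polys n"
  using ideal_sub by blast

lemma ideal_zero: "0 \<in> I"
  using additive_subgroup.zero_closed[OF is_additive_subgroup] by simp

lemma ideal_add: "f \<in> I \<Longrightarrow> g \<in> I \<Longrightarrow> f + g \<in> I"
  using additive_subgroup.a_closed[OF is_additive_subgroup] by simp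

lemma ideal_mult: "r \<in> polys n \<Longrightarrow> f \<in> I \<Longrightarrow> r * f \<in> I"
  using I_l_closed by simp

lemma ideal_uminus: "f \<in> I \<Longrightarrow> - f \<in> I"
  using ideal_mult[of "- 1" f] by simp

lemma ideal_diff: "f \<in> I \<Longrightarrow> g \<in> I \<Longrightarrow> f - g \<in> I"
  using ideal_add[of f "- g"] ideal_uminus by simp

end

text \<open>Vanishing of a single functional is not stable under multiplication; vanishing of all
  its translates by monomials is.  This is how functionals will bound an ideal from above.\<close>

lemma ideal_translates_vanish:
  "ideal {g \<in> polys n. \<forall>h\<in>mons n. lin_ext (\<lambda>s. w (h + s)) g = 0} (poly_ring n)"
proof (rule ideal_poly_ringI)
  fix f r
  assume f: "f \<in> {g \<in> polys n. \<forall>h\<in>mons n. lin_ext (\<lambda>s. w (h + s)) g = 0}" and r: "r \<in> polys n"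
  have "lin_ext (\<lambda>s. w (h + s)) (r * f) = 0" if h: "h \<in> mons n" for h
  proof -
    have "lin_ext (\<lambda>s. w (h + s)) (r * f) = lin_ext (\<lambda>s. 0) r"
      unfolding lin_ext_mult
    proof (rule lin_ext_cong)
      fix s assume "s \<in> Poly_Mapping.keys r"
      with r h have "h + s \<in> mons n" by (auto simp: polys_iff)
      with f have "lin_ext (\<lambda>t. w ((h + s) + t)) f = 0" by blast
      then show "lin_ext (\<lambda>t. w (h + (s + t))) f = 0" by (simp only: add.assoc)
    qed
    then show ?thesis by (simp add: lin_ext_def)
  qed
  with f r show "r * f \<in> {g \<in> polys n. \<forall>h\<in>mons n. lin_ext (\<lambda>s. w (h + s)) g = 0}"
    by auto
qed (auto simp: lin_ext_add)

section \<open>Top components\<close>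

lemma lookup_top_component:
  "Poly_Mapping.lookup (top_component f) t =
    (if mon_degree t = total_degree f then Poly_Mapping.lookup f t else 0)"
  by (auto simp: top_component_def lookup_sum lookup_single when_def in_keys_iff)

lemma keys_top_component:
  "Poly_Mapping.keys (top_component f) = {t \<in> Poly_Mapping.keys f. mon_degree t = total_degree f}"
  by (auto simp: in_keys_iff lookup_top_component split: if_splits)

lemma top_component_polys: "f \<in> polys n \<Longrightarrow> top_component f \<in> polys n"
  by (auto simp: polys_iff keys_top_component)

lemma mon_degree_le_total_degree:
  "t \<in> Poly_Mapping.keys f \<Longrightarrow> mon_degree t \<le> total_degree f"
  by (auto simp: total_degree_def intro!: Max_ge)

lemma top_component_homogeneous_plus_lower:
  assumes "g \<noteq> 0" "\<And>t. t \<in> Poly_Mapping.keys g \<Longrightarrow> mon_degree t = d"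
    and "\<And>t. t \<in> Poly_Mapping.keys h \<Longrightarrow> mon_degree t < d"
  shows "top_component (g + h) = g"
proof -
  have low: "Poly_Mapping.lookup h t = 0" if "mon_degree t \<ge> d" for t
    using that assms(3)[of t] by (auto simp: in_keys_iff)
  have hom: "Poly_Mapping.lookup g t = 0" if "mon_degree t \<noteq> d" for t
    using that assms(2)[of t] by (auto simp: in_keys_iff)
  obtain t0 where t0: "t0 \<in> Poly_Mapping.keys g"
    using assms(1) keys_eq_empty[of g] by blast
  have "total_degree (g + h) = d"
    unfolding total_degree_def
  proof (rule Max_eqI)
    fix y assume "y \<in> mon_degree ` Poly_Mapping.keys (g + h)"
    then show "y \<le> d"
      using keys_add[of g h] assms(2,3) by (fastforce dest: less_imp_le)
  next
    have "t0 \<in> Poly_Mapping.keys (g + h)"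
      using t0 assms(2)[OF t0] low[of t0] by (auto simp: in_keys_iff lookup_add)
    then show "d \<in> mon_degree ` Poly_Mapping.keys (g + h)"
      using assms(2)[OF t0] by blast
  qed simp
  then show ?thesis
    by (intro poly_mapping_eqI) (auto simp: lookup_top_component lookup_add low hom)
qed

section \<open>The equivalence relation generated by a graph\<close>

lemma equiv_rules:
  assumes "equiv V r"
  shows "(x, y) \<in> r \<Longrightarrow> (y, x) \<in> r"
    and "(x, y) \<in> r \<Longrightarrow> (y, z) \<in> r \<Longrightarrow> (x, z) \<in> r"
    and "(x, y) \<in> r \<Longrightarrow> x \<in> V" and "(x, y) \<in> r \<Longrightarrow> y \<in> V"
    and "x \<in> V \<Longrightarrow> (x, x) \<in> r"
proof -
  have *: "r \<subseteq> V \<times> V" "refl_on V r" "sym r" "trans r"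
    using assms by (rule equivE, simp)+
  show "(x, y) \<in> r \<Longrightarrow> (y, x) \<in> r" by (rule symD[OF *(3)])
  show "(x, y) \<in> r \<Longrightarrow> (y, z) \<in> r \<Longrightarrow> (x, z) \<in> r" by (rule transD[OF *(4)])
  show "(x, y) \<in> r \<Longrightarrow> x \<in> V" "(x, y) \<in> r \<Longrightarrow> y \<in> V" using *(1) by auto
  show "x \<in> V \<Longrightarrow> (x, x) \<in> r" by (rule refl_onD[OF *(2)])
qed

lemma connection_refl: "x \<in> V \<Longrightarrow> (x, x) \<in> connection V E"
  by (simp add: connection_def)

lemma equiv_connection: "equiv V (connection V E)"
proof (rule equivI)
  have "sym ({(x, y). {x, y} \<in> E}\<^sup>*)"
    by (rule sym_rtrancl) (auto simp: sym_def insert_commute)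
  then show "sym (connection V E)"
    by (auto simp: connection_def sym_def)
  show "trans (connection V E)"
    by (auto simp: connection_def trans_def)
qed (auto simp: connection_def refl_on_def)

lemma pairs_doubleton_iff: "{x, y} \<in> pairs V \<longleftrightarrow> x \<in> V \<and> y \<in> V \<and> x \<noteq> y"
  by (cases "x = y") (auto simp: pairs_def)

lemma pairsE:
  assumes "S \<in> pairs V"
  obtains i j where "S = {i, j}" "i \<in> V" "j \<in> V" "i \<noteq> j"
proof -
  from assms obtain i j where "S = {i, j}" "i \<noteq> j"
    unfolding pairs_def card_2_iff by blast
  with assms that show thesis by (auto simp: pairs_def)
qed

lemma edge_in_connection: "E \<subseteq> pairs V \<Longrightarrow> {x, y} \<in> E \<Longrightarrow> (x, y) \<in> connection V E"
  by (auto simp: connection_def dest!: subsetD simp: pairs_doubleton_iff)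

lemma connection_subset_iff:
  assumes E: "E \<subseteq> pairs V" and r: "equiv V r"
  shows "connection V E \<subseteq> r \<longleftrightarrow> (\<forall>x y. {x, y} \<in> E \<longrightarrow> (x, y) \<in> r)"
proof
  assume *: "\<forall>x y. {x, y} \<in> E \<longrightarrow> (x, y) \<in> r"
  have "(u, v) \<in> r" if "(u, v) \<in> {(x, y). {x, y} \<in> E}\<^sup>*" "u \<in> V" for u v
    using that
  proof (induction rule: rtrancl_induct)
    case base
    then show ?case by (rule equiv_rules(5)[OF r])
  next
    case (step y z)
    then show ?case using * equiv_rules(2)[OF r, of u y z] by auto
  qed
  then show "connection V E \<subseteq> r"
    by (auto simp: connection_def)
qed (use edge_in_connection[OF E] in blast)

text \<open>Writing the fused class as the square of a single set, also when \<open>i\<close> and \<open>j\<close> are already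
  related, keeps transitivity easy to see.\<close>

definition merge :: "('a \<times> 'a) set \<Rightarrow> 'a \<Rightarrow> 'a \<Rightarrow> ('a \<times> 'a) set" where
  "merge r i j = r \<union> r `` {i, j} \<times> r `` {i, j}"

lemma equiv_merge:
  assumes r: "equiv V r"
  shows "equiv V (merge r i j)"
proof -
  note sym = equiv_rules(1)[OF r] and trans = equiv_rules(2)[OF r]
    and dom = equiv_rules(3,4)[OF r] and refl = equiv_rules(5)[OF r]
  show ?thesis
  proof (rule equivI)
    show "merge r i j \<subseteq> V \<times> V" using dom by (auto simp: merge_def)
    show "refl_on V (merge r i j)" using refl by (auto simp: merge_def refl_on_def)
    show "sym (merge r i j)" by (rule symI) (auto simp: merge_def intro: sym)
    show "trans (merge r i j)"
    proof (rule transI)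
      fix x y z assume "(x, y) \<in> merge r i j" "(y, z) \<in> merge r i j"
      then show "(x, z) \<in> merge r i j"
        using trans[of x y z] trans[of _ y z] trans[of _ y x] sym[of x y]
        unfolding merge_def by auto
    qed
  qed
qed

text \<open>Both sides are the least equivalence relation that contains \<open>connection V E\<close> and \<open>(i, j)\<close>.\<close>

lemma connection_insert:
  assumes E: "E \<subseteq> pairs V" and ij: "i \<in> V" "j \<in> V" "i \<noteq> j"
  shows "connection V (insert {i, j} E) = merge (connection V E) i j" (is "?L = ?R")
proof
  let ?E = "insert {i, j} E" and ?c = "connection V E"
  have E': "?E \<subseteq> pairs V" using E ij by (simp add: pairs_doubleton_iff)
  have eqc: "equiv V ?c" and eqL: "equiv V ?L" by (rule equiv_connection)+
  have "(x, y) \<in> ?R" if "{x, y} \<in> ?E" for x y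
    using that edge_in_connection[OF E, of x y] connection_refl[OF ij(1), of E]
      connection_refl[OF ij(2), of E]
    by (auto simp: merge_def doubleton_eq_iff)
  then show "?L \<subseteq> ?R"
    using connection_subset_iff[OF E' equiv_merge[OF eqc]] by blast
  have "?c \<subseteq> ?L"
    using connection_subset_iff[OF E eqL] edge_in_connection[OF E'] by blast
  moreover have "(i, j) \<in> ?L"
    by (rule edge_in_connection[OF E']) simp
  moreover have sym: "(y, x) \<in> ?L" if "(x, y) \<in> ?L" for x y
    using that equiv_rules(1)[OF eqL] by blast
  moreover have trans: "(x, z) \<in> ?L" if "(x, y) \<in> ?L" "(y, z) \<in> ?L" for x y z
    using that equiv_rules(2)[OF eqL] by blast
  ultimately have "(i, x) \<in> ?L" if "x \<in> ?c `` {i, j}" for x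
    using that by blast
  then have "(x, y) \<in> ?L" if "x \<in> ?c `` {i, j}" "y \<in> ?c `` {i, j}" for x y
    using that trans[OF sym, of i x y] by blast
  with \<open>?c \<subseteq> ?L\<close> show "?R \<subseteq> ?L"
    unfolding merge_def by auto
qed

section \<open>Forests\<close>

lemma rtrancl_distinct_path:
  assumes "(a, b) \<in> R\<^sup>*"
  obtains vs where "vs \<noteq> []" "distinct vs" "hd vs = a" "last vs = b"
    "successively (\<lambda>x y. (x, y) \<in> R) vs"
proof -
  have "\<exists>vs. vs \<noteq> [] \<and> distinct vs \<and> hd vs = a \<and> last vs = b \<and>
      successively (\<lambda>x y. (x, y) \<in> R) vs"
    using assms
  proof (induction rule: rtrancl_induct)
    case base
    then show ?case by (intro exI[of _ "[a]"]) auto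
  next
    case (step y z)
    then obtain vs where vs: "vs \<noteq> []" "distinct vs" "hd vs = a" "last vs = y"
      "successively (\<lambda>x y. (x, y) \<in> R) vs" by blast
    show ?case
    proof (cases "z \<in> set vs")
      case True
      then obtain us ws where us: "vs = us @ z # ws" by (auto dest: split_list)
      show ?thesis
        by (rule exI[of _ "us @ [z]"])
           (use vs us in \<open>auto simp: successively_append_iff hd_append\<close>)
    next
      case False
      show ?thesis
        by (rule exI[of _ "vs @ [z]"])
           (use vs False step in \<open>auto simp: successively_append_iff hd_append\<close>)
    qed
  qed
  with that show thesis by blast
qed

text \<open>If the ends of the new edge were already connected, a path between them without
  repetitions would close up with that edge to a cycle; it has at least three vertices because the
  edge is new.\<close>

lemma forest_insertD:
  assumes F: "forest V (insert {i, j} E)" and new: "{i, j} \<notin> E" and ij: "i \<noteq> j"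
  shows "forest V E" "(i, j) \<notin> connection V E"
proof -
  show "forest V E"
    using F by (auto simp: forest_def simple_graph_def is_cycle_def)
  show "(i, j) \<notin> connection V E"
  proof
    assume "(i, j) \<in> connection V E"
    then have "(i, j) \<in> {(x, y). {x, y} \<in> E}\<^sup>*" by (simp add: connection_def)
    then obtain vs where vs: "vs \<noteq> []" "distinct vs" "hd vs = i" "last vs = j"
      "successively (\<lambda>x y. (x, y) \<in> {(x, y). {x, y} \<in> E}) vs"
      by (rule rtrancl_distinct_path)
    have edge: "{vs ! k, vs ! Suc k} \<in> E" if "Suc k < length vs" for k
      using vs(5) that by (auto simp: successively_conv_nth)
    have "length vs \<noteq> 1"
      using vs ij by (auto simp: length_Suc_conv)
    moreover have "length vs \<noteq> 2"
      using vs edge[of 0] new by (auto simp: hd_conv_nth last_conv_nth)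
    ultimately have "length vs \<ge> 3"
      using vs(1) by (cases "length vs") auto
    moreover have "{vs ! k, vs ! (Suc k mod length vs)} \<in> insert {i, j} E"
      if k: "k < length vs" for k
    proof (cases "Suc k = length vs")
      case True
      then have "vs ! k = j" using vs by (simp add: last_conv_nth flip: True)
      moreover have "vs ! 0 = i" using vs by (simp add: hd_conv_nth)
      ultimately show ?thesis using True by (simp add: insert_commute)
    next
      case False
      with k edge[of k] show ?thesis by simp
    qed
    ultimately have "is_cycle (insert {i, j} E) vs"
      using vs by (auto simp: is_cycle_def)
    with F show False by (auto simp: forest_def)
  qed
qed

text \<open>On a cycle every vertex has two different neighbours.  A vertex that is not a fixed point of
  the parent function is joined only to its parent, since the parent is a fixed point.  So all
  vertices of a cycle are fixed points, whereas each edge needs one that is not.\<close>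

lemma parent_edges_acyclic:
  assumes E: "\<And>S. S \<in> E \<Longrightarrow> \<exists>x. S = {x, p x} \<and> p x \<noteq> x \<and> p (p x) = p x"
  shows "\<not> is_cycle E vs"
proof
  assume cyc: "is_cycle E vs"
  define v where "v k = vs ! (k mod length vs)" for k
  have len: "length vs \<ge> 3" and dist: "distinct vs"
    using cyc by (auto simp: is_cycle_def)
  have edge: "{v k, v (Suc k)} \<in> E" for k
  proof -
    have "k mod length vs < length vs" using len by (intro mod_less_divisor) auto
    with cyc have "{vs ! (k mod length vs), vs ! (Suc (k mod length vs) mod length vs)} \<in> E"
      unfolding is_cycle_def by blast
    then show ?thesis by (simp add: v_def mod_Suc_eq)
  qed
  have parent: "v (Suc k) = p (v k) \<and> p (v (Suc k)) = v (Suc k) \<or>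
      v k = p (v (Suc k)) \<and> p (v k) = v k" and ne: "v k \<noteq> v (Suc k)" for k
  proof -
    obtain x where x: "{v k, v (Suc k)} = {x, p x}" "p x \<noteq> x" "p (p x) = p x"
      using E[OF edge[of k]] by blast
    then consider "v k = x" "v (Suc k) = p x" | "v k = p x" "v (Suc k) = x"
      unfolding doubleton_eq_iff by blast
    then show "v (Suc k) = p (v k) \<and> p (v (Suc k)) = v (Suc k) \<or>
        v k = p (v (Suc k)) \<and> p (v k) = v k"
      by cases (simp_all only: x simp_thms)
    show "v k \<noteq> v (Suc k)" using x(1,2) by (metis doubleton_eq_iff)
  qed
  have next2: "v k \<noteq> v (Suc (Suc k))" for k
  proof
    have pos: "i mod length vs < length vs" for i
      using len by (intro mod_less_divisor) auto
    assume "v k = v (Suc (Suc k))"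
    then have "Suc (Suc k) mod length vs = k mod length vs"
      unfolding v_def nth_eq_iff_index_eq[OF dist pos pos] by (rule sym)
    then have "length vs dvd Suc (Suc k) - k"
      by (subst (asm) mod_eq_dvd_iff_nat) simp_all
    then show False using len by (auto dest: dvd_imp_le)
  qed
  \<comment> \<open>Both neighbours of a vertex that is not its own parent are its parent.\<close>
  have fixed: "p (v (Suc k)) = v (Suc k)" for k
    using parent[of k] parent[of "Suc k"] next2[of k] by metis
  show False
    using parent[of 1] fixed[of 0] fixed[of 1] ne[of 1] by simp
qed

lemma star_tree:
  assumes "finite A" "c \<in> A"
  shows "tree A ((\<lambda>x. {x, c}) ` (A - {c}))" (is "tree A ?E")
proof -
  have sub: "?E \<subseteq> pairs A" using assms by (auto simp: pairs_doubleton_iff)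
  have "\<not> is_cycle ?E vs" for vs
    by (rule parent_edges_acyclic[where p = "\<lambda>_. c"]) auto
  moreover have "connected_graph A ?E"
  proof -
    have "(u, c) \<in> connection A ?E" if "u \<in> A" for u
      using that assms edge_in_connection[OF sub, of u c]
      by (cases "u = c") (auto simp: connection_refl)
    then show ?thesis
      using assms equiv_rules(1,2)[OF equiv_connection[of A ?E]]
      unfolding connected_graph_def by (metis empty_iff)
  qed
  ultimately show ?thesis
    using sub assms by (auto simp: tree_def forest_def simple_graph_def)
qed

section \<open>Roots of classes and rank\<close>

text \<open>The minimum is a representative that depends on the class alone, so the star monomials
  built from it are attached to the equivalence relation without further choices.\<close>

definition root_of :: "('a::linorder \<times> 'a) set \<Rightarrow> 'a \<Rightarrow> 'a" where
  "root_of r x = Min (r `` {x})"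

definition nonroots :: "'a::linorder set \<Rightarrow> ('a \<times> 'a) set \<Rightarrow> 'a set" where
  "nonroots V r = {x \<in> V. root_of r x \<noteq> x}"

text \<open>The number of elements minus the number of classes, which is the number of edges of any
  spanning forest.\<close>

definition rank :: "'a::linorder set \<Rightarrow> ('a \<times> 'a) set \<Rightarrow> nat" where
  "rank V r = card (nonroots V r)"

context
  fixes V :: "'a::linorder set" and r :: "('a \<times> 'a) set"
  assumes fin: "finite V" and eqv: "equiv V r"
begin

lemmas eqv_rules = equiv_rules[OF eqv]

lemma finite_class: "finite (r `` {x})"
  by (rule finite_subset[OF _ fin]) (use eqv_rules(4) in blast)

lemma root_rel: "x \<in> V \<Longrightarrow> (x, root_of r x) \<in> r"
  using Min_in[OF finite_class, of x] eqv_rules(5) by (auto simp: root_of_def)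

lemma root_in: "x \<in> V \<Longrightarrow> root_of r x \<in> V"
  using root_rel eqv_rules(4) by blast

lemma root_eq_iff: "x \<in> V \<Longrightarrow> y \<in> V \<Longrightarrow> root_of r x = root_of r y \<longleftrightarrow> (x, y) \<in> r"
proof
  assume "x \<in> V" "y \<in> V" "root_of r x = root_of r y"
  then show "(x, y) \<in> r" using root_rel[of x] root_rel[of y] by (metis eqv_rules(1,2))
next
  assume "(x, y) \<in> r"
  then have "r `` {x} = r `` {y}" by (rule equiv_class_eq[OF eqv])
  then show "root_of r x = root_of r y" by (simp add: root_of_def)
qed

lemma root_root: "x \<in> V \<Longrightarrow> root_of r (root_of r x) = root_of r x"
  using root_eq_iff[of "root_of r x" x] root_in[of x] eqv_rules(1)[OF root_rel[of x]] by blast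

lemma finite_nonroots: "finite (nonroots V r)"
  using fin by (simp add: nonroots_def)

lemma merge_same:
  assumes "(i, j) \<in> r"
  shows "merge r i j = r"
proof -
  have "(x, y) \<in> r" if "(i, x) \<in> r" "(i, y) \<in> r" for x y
    using that eqv_rules(2)[OF eqv_rules(1)] by blast
  moreover have "r `` {j} = r `` {i}"
    using equiv_class_eq[OF eqv assms] by simp
  ultimately show ?thesis by (auto simp: merge_def)
qed

lemma root_merge:
  assumes ij: "i \<in> V" "j \<in> V" "(i, j) \<notin> r" and x: "x \<in> V"
  shows "root_of (merge r i j) x =
    (if root_of r x \<in> {root_of r i, root_of r j} then min (root_of r i) (root_of r j) else root_of r x)"
proof -
  have cls: "merge r i j `` {x} =
      (if (x, i) \<in> r \<or> (x, j) \<in> r then r `` {i} \<union> r `` {j} else r `` {x})"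
  proof (cases "(x, i) \<in> r \<or> (x, j) \<in> r")
    case True
    then have "r `` {x} \<subseteq> r `` {i, j}"
      using equiv_class_eq[OF eqv, of x i] equiv_class_eq[OF eqv, of x j] by blast
    moreover have "x \<in> r `` {i, j}"
      using True eqv_rules(1) by blast
    ultimately show ?thesis
      using True unfolding merge_def by auto
  next
    case False
    then have "x \<notin> r `` {i, j}"
      using eqv_rules(1) by blast
    then show ?thesis
      using False unfolding merge_def by auto
  qed
  have "(x, i) \<in> r \<or> (x, j) \<in> r \<longleftrightarrow> root_of r x \<in> {root_of r i, root_of r j}"
    using ij x by (auto simp: root_eq_iff)
  moreover have "Min (r `` {i} \<union> r `` {j}) = min (root_of r i) (root_of r j)"
    unfolding root_of_def
    by (rule Min_Un) (use ij eqv_rules(5) finite_class in auto)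
  ultimately show ?thesis
    by (simp add: root_of_def cls)
qed

text \<open>The fused class keeps the smaller of the two roots, and only the larger one is lost.\<close>

lemma nonroots_merge:
  assumes ij: "i \<in> V" "j \<in> V" "(i, j) \<notin> r"
  defines "b \<equiv> max (root_of r i) (root_of r j)"
  shows "b \<notin> nonroots V r" "nonroots V (merge r i j) = insert b (nonroots V r)"
proof -
  have ne: "root_of r i \<noteq> root_of r j" using ij root_eq_iff by blast
  have rb: "root_of r b = b" "b \<in> V"
    using ij by (auto simp: b_def max_def root_root root_in)
  then show "b \<notin> nonroots V r" by (simp add: nonroots_def)
  show "nonroots V (merge r i j) = insert b (nonroots V r)"
  proof (rule Set.set_eqI, rule iffI)
    fix x assume x: "x \<in> nonroots V (merge r i j)"
    then have xV: "x \<in> V" by (simp add: nonroots_def)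
    show "x \<in> insert b (nonroots V r)"
      using x xV root_merge[OF ij xV]
      by (auto simp: nonroots_def b_def min_def max_def split: if_splits)
  next
    fix x assume x: "x \<in> insert b (nonroots V r)"
    then have xV: "x \<in> V" using rb by (auto simp: nonroots_def)
    show "x \<in> nonroots V (merge r i j)"
    proof (cases "x = b")
      case True
      then show ?thesis using root_merge[OF ij xV] rb ne
        by (auto simp: nonroots_def b_def min_def max_def split: if_splits)
    next
      case False
      then have "root_of r x \<noteq> x" using x by (auto simp: nonroots_def)
      then show ?thesis using root_merge[OF ij xV] ij xV
        by (auto simp: nonroots_def min_def root_root split: if_splits)
    qed
  qed
qed

lemma rank_merge: "i \<in> V \<Longrightarrow> j \<in> V \<Longrightarrow> (i, j) \<notin> r \<Longrightarrow> rank V (merge r i j) = Suc (rank V r)"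
  by (simp add: rank_def nonroots_merge finite_nonroots)

end

lemma connection_empty: "connection V {} = Id_on V"
proof -
  have "{(x, y). {x, y} \<in> ({} :: 'a set set)} = {}" by simp
  then show ?thesis by (auto simp: connection_def simp del: empty_iff)
qed

lemma nonroots_Id_on: "nonroots V (Id_on V) = {}"
proof -
  have "Id_on V `` {x} = {x}" if "x \<in> V" for x using that by auto
  then show ?thesis by (auto simp: nonroots_def root_of_def)
qed

text \<open>An edge raises the rank by one when it joins two classes and leaves it unchanged otherwise;
  in a forest the second case never occurs.\<close>

lemma rank_connection:
  assumes V: "finite V" and E: "E \<subseteq> pairs V"
  shows "rank V (connection V E) \<le> card E"
    and "forest V E \<Longrightarrow> rank V (connection V E) = card E"
proof -
  have "finite (pairs V)" using V by (simp add: pairs_def)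
  then have "finite E" using E finite_subset by blast
  then have "rank V (connection V E) \<le> card E \<and>
    (forest V E \<longrightarrow> rank V (connection V E) = card E)"
    using E
  proof (induction E rule: finite_induct)
    case empty
    then show ?case by (simp add: connection_empty rank_def nonroots_Id_on)
  next
    case (insert S E)
    then obtain i j where S: "S = {i, j}" "i \<in> V" "j \<in> V" "i \<noteq> j" by (auto elim!: pairsE)
    have E: "E \<subseteq> pairs V" using insert by simp
    have conn: "connection V (insert S E) = merge (connection V E) i j"
      unfolding S(1) by (rule connection_insert[OF E S(2-4)])
    show ?case
    proof (cases "(i, j) \<in> connection V E")
      case True
      have "\<not> forest V (insert S E)"
        using forest_insertD(2)[of V i j E] insert.hyps S True by blast
      then show ?thesis
        using insert True by (simp add: conn merge_same[OF V equiv_connection])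
    next
      case False
      then show ?thesis
        using insert S forest_insertD(1)[of V i j E] rank_merge[OF V equiv_connection, of i j E]
        unfolding conn by auto
    qed
  qed
  then show "rank V (connection V E) \<le> card E"
    "forest V E \<Longrightarrow> rank V (connection V E) = card E" by auto
qed

text \<open>Joining every element to the root of its class gives a forest with prescribed components.\<close>

lemma star_forest_exists:
  fixes V :: "'a::linorder set"
  assumes V: "finite V" and r: "equiv V r"
  obtains E where "forest V E" "connection V E = r"
proof
  let ?E = "(\<lambda>x. {x, root_of r x}) ` nonroots V r"
  have sub: "?E \<subseteq> pairs V"
    using root_in[OF V r] by (auto simp: nonroots_def pairs_doubleton_iff)
  have "\<not> is_cycle ?E vs" for vs
    by (rule parent_edges_acyclic[where p = "root_of r"])
       (use root_root[OF V r] in \<open>auto simp: nonroots_def\<close>)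
  then show "forest V ?E"
    using V sub by (simp add: forest_def simple_graph_def)
  note conn = equiv_rules[OF equiv_connection[of V ?E]]
  show "connection V ?E = r"
  proof
    have "(x, y) \<in> r" if xy: "{x, y} \<in> ?E" for x y
    proof -
      obtain z where z: "{x, y} = {z, root_of r z}" "z \<in> V"
        using xy by (auto simp: nonroots_def)
      from root_rel[OF V r z(2)] have "(z, root_of r z) \<in> r" "(root_of r z, z) \<in> r"
        using equiv_rules(1)[OF r] by blast+
      then show ?thesis using z(1) by (auto simp: doubleton_eq_iff)
    qed
    then show "connection V ?E \<subseteq> r"
      using connection_subset_iff[OF sub r] by blast
    have to_root: "(x, root_of r x) \<in> connection V ?E" if "x \<in> V" for x
    proof (cases "root_of r x = x")
      case True
      then show ?thesis using conn(5)[OF that] by simp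
    next
      case False
      then show ?thesis using that by (intro edge_in_connection[OF sub]) (auto simp: nonroots_def)
    qed
    show "r \<subseteq> connection V ?E"
    proof (rule subrelI)
      fix x y assume xy: "(x, y) \<in> r"
      then have V': "x \<in> V" "y \<in> V" by (rule equiv_rules(3,4)[OF r])+
      then have "root_of r x = root_of r y" using xy root_eq_iff[OF V r] by blast
      then show "(x, y) \<in> connection V ?E"
        using conn(2)[OF to_root[OF V'(1)]] conn(1)[OF to_root[OF V'(2)]] by simp
    qed
  qed
qed

definition part_rel :: "'a set set \<Rightarrow> ('a \<times> 'a) set" where
  "part_rel P = {(x, y). \<exists>p\<in>P. x \<in> p \<and> y \<in> p}"

lemma part_rel_quotient:
  assumes "equiv V r"
  shows "part_rel (V // r) = r"
proof -
  have "(\<exists>p\<in>V // r. x \<in> p \<and> y \<in> p) \<longleftrightarrow> (x, y) \<in> r" for x y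
  proof
    assume "\<exists>p\<in>V // r. x \<in> p \<and> y \<in> p"
    then obtain z where "(z, x) \<in> r" "(z, y) \<in> r" by (auto elim!: quotientE)
    then show "(x, y) \<in> r" using equiv_rules(2)[OF assms equiv_rules(1)[OF assms]] by blast
  next
    assume xy: "(x, y) \<in> r"
    then have "x \<in> V" by (rule equiv_rules(3)[OF assms])
    then show "\<exists>p\<in>V // r. x \<in> p \<and> y \<in> p"
      using xy equiv_rules(5)[OF assms, of x]
      by (intro bexI[of _ "r `` {x}"]) (auto intro: quotientI)
  qed
  then show ?thesis by (simp add: part_rel_def)
qed

section \<open>Reduction to star monomials\<close>

\<comment> \<open>Vertex sets stay in the form \<open>{1..n}\<close> instead of becoming \<open>{Suc 0..n}\<close>.\<close>
declare One_nat_def [simp del]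

lemma I_ideal_generators:
  defines "G \<equiv> \<lambda>n m. {var S ^ 2 | S. S \<in> pairs {1..n}}
     \<union> {var {i, j} * var {j, k} - var {i, k} * var {j, k} | i j k.
          {i, j, k} \<subseteq> {1..n} \<and> i \<noteq> j \<and> j \<noteq> k \<and> i \<noteq> k}
     \<union> {graph_monomial E | V E. V \<subseteq> {1..n} \<and> card V = m + 1 \<and> tree V E}"
  shows ideal_I_ideal: "ideal (I_ideal n m) (poly_ring n)"
    and I_ideal_square: "S \<in> pairs {1..n} \<Longrightarrow> var S * var S \<in> I_ideal n m"
    and I_ideal_triangle: "i \<in> {1..n} \<Longrightarrow> j \<in> {1..n} \<Longrightarrow> k \<in> {1..n} \<Longrightarrow> i \<noteq> j \<Longrightarrow> j \<noteq> k \<Longrightarrow> i \<noteq> k \<Longrightarrow>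
      var {i, j} * var {j, k} - var {i, k} * var {j, k} \<in> I_ideal n m"
    and I_ideal_tree: "V \<subseteq> {1..n} \<Longrightarrow> card V = m + 1 \<Longrightarrow> tree V E \<Longrightarrow> graph_monomial E \<in> I_ideal n m"
    and I_ideal_minimal: "ideal J (poly_ring n) \<Longrightarrow> G n m \<subseteq> J \<Longrightarrow> I_ideal n m \<subseteq> J"
proof -
  interpret cring "poly_ring n" by (rule cring_poly_ring)
  have I: "I_ideal n m = Idl\<^bsub>poly_ring n\<^esub> (G n m)"
    unfolding I_ideal_def G_def ..
  have "E \<subseteq> pairs {1..n}" if "V \<subseteq> {1..n}" "tree V E" for V E
    using that by (auto simp: tree_def forest_def simple_graph_def pairs_def)
  then have G: "G n m \<subseteq> polys n"
    unfolding G_def power2_eq_square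
    by (auto simp: pairs_doubleton_iff intro!: polys_diff polys_mult)
  show "ideal (I_ideal n m) (poly_ring n)"
    unfolding I by (rule genideal_ideal[OF G])
  have sub: "G n m \<subseteq> I_ideal n m"
    unfolding I by (rule genideal_self[OF G])
  show "S \<in> pairs {1..n} \<Longrightarrow> var S * var S \<in> I_ideal n m"
    by (rule subsetD[OF sub]) (auto simp: G_def simp flip: power2_eq_square)
  show "i \<in> {1..n} \<Longrightarrow> j \<in> {1..n} \<Longrightarrow> k \<in> {1..n} \<Longrightarrow> i \<noteq> j \<Longrightarrow> j \<noteq> k \<Longrightarrow> i \<noteq> k \<Longrightarrow>
      var {i, j} * var {j, k} - var {i, k} * var {j, k} \<in> I_ideal n m"
    by (rule subsetD[OF sub]) (unfold G_def, blast)
  show "V \<subseteq> {1..n} \<Longrightarrow> card V = m + 1 \<Longrightarrow> tree V E \<Longrightarrow> graph_monomial E \<in> I_ideal n m"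
    by (rule subsetD[OF sub]) (unfold G_def, blast)
  show "ideal J (poly_ring n) \<Longrightarrow> G n m \<subseteq> J \<Longrightarrow> I_ideal n m \<subseteq> J"
    unfolding I by (rule genideal_minimal)
qed

text \<open>The variable of an edge, with the convention that a loop counts as zero.  This lets both
  ends of an edge move freely modulo \<open>I_ideal n m\<close>: an edge that would collapse to a loop turns
  out to be congruent to zero.\<close>

definition edge_var :: "nat \<Rightarrow> nat \<Rightarrow> mpoly" where
  "edge_var i j = (if i = j then 0 else var {i, j})"

lemma edge_var_commute: "edge_var i j = edge_var j i"
  by (simp add: edge_var_def insert_commute)

lemma edge_var_polys [simp]: "i \<in> {1..n} \<Longrightarrow> j \<in> {1..n} \<Longrightarrow> edge_var i j \<in> polys n"
  by (simp add: edge_var_def pairs_doubleton_iff del: atLeastAtMost_iff)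

definition star_poly :: "nat \<Rightarrow> (nat \<times> nat) set \<Rightarrow> mpoly" where
  "star_poly n r = (\<Prod>x\<in>nonroots {1..n} r. edge_var x (root_of r x))"

text \<open>The factor \<open>y\<close> acts as a catalyst: it allows each factor of the product to be replaced
  and is still there afterwards.\<close>

lemma prod_congruence:
  assumes "ideal I (poly_ring n)" "finite A" "\<And>x. x \<in> A \<Longrightarrow> u x \<in> polys n" "\<And>x. x \<in> A \<Longrightarrow> v x \<in> polys n"
    "\<And>x. x \<in> A \<Longrightarrow> y * (u x - v x) \<in> I"
  shows "y * (prod u A - prod v A) \<in> I"
  using assms(2-)
proof (induction A rule: finite_induct)
  case empty
  then show ?case by (simp add: ideal_zero[OF assms(1)])
next
  case (insert x A)
  have "u x * (y * (prod u A - prod v A)) + prod v A * (y * (u x - v x)) \<in> I"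
    by (intro ideal_add[OF assms(1)] ideal_mult[OF assms(1)] polys_prod insert) (use insert in auto)
  then show ?case
    using insert.hyps by (simp add: algebra_simps)
qed

context
  fixes n m :: nat and r :: "(nat \<times> nat) set"
  assumes r: "equiv {1..n} r"
begin

lemmas root_in_vertices = root_in[OF finite_atLeastAtMost r]

text \<open>The star monomial contains the edge from \<open>i\<close> to its root, so a triangle relation moves the
  end \<open>i\<close> of a further edge along it.  If the triangle degenerates, a square appears.\<close>

lemma slide_one_end:
  assumes i: "i \<in> {1..n}" and j: "j \<in> {1..n}"
  shows "(edge_var i j - edge_var (root_of r i) j) * star_poly n r \<in> I_ideal n m"
proof (cases "root_of r i = i")
  case True
  then show ?thesis by (simp add: ideal_zero[OF ideal_I_ideal])
next
  case False
  define a where "a = root_of r i"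
  \<comment> \<open>The factor of the star monomial that makes the slide possible is split off.\<close>
  define Q where "Q = (\<Prod>x\<in>nonroots {1..n} r - {i}. edge_var x (root_of r x))"
  have a: "a \<in> {1..n}" "a \<noteq> i" using False i by (simp_all add: a_def root_in_vertices del: atLeastAtMost_iff)
  have star: "star_poly n r = edge_var i a * Q"
    unfolding star_poly_def Q_def a_def
    by (rule prod.remove) (use i False in \<open>auto simp: nonroots_def\<close>)
  have Q: "Q \<in> polys n"
    unfolding Q_def
    by (rule polys_prod) (auto simp: nonroots_def root_in_vertices simp del: atLeastAtMost_iff)
  have sq: "edge_var x y * edge_var x y \<in> I_ideal n m" if "x \<in> {1..n}" "y \<in> {1..n}" for x y
    using that I_ideal_square[of "{x, y}" n m]
    by (auto simp: edge_var_def pairs_doubleton_iff ideal_zero[OF ideal_I_ideal])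
  have "(edge_var i j - edge_var a j) * edge_var i a \<in> I_ideal n m"
  proof -
    consider "j = i" | "j = a" | "j \<noteq> i" "j \<noteq> a" by blast
    then show ?thesis
    proof cases
      case 1
      then have "(edge_var i j - edge_var a j) * edge_var i a = - (edge_var i a * edge_var i a)"
        by (simp add: edge_var_def insert_commute)
      then show ?thesis using ideal_uminus[OF ideal_I_ideal sq] i a by simp
    next
      case 2
      then have "(edge_var i j - edge_var a j) * edge_var i a = edge_var i a * edge_var i a"
        by (simp add: edge_var_def)
      then show ?thesis using sq i a by simp
    next
      case 3
      then show ?thesis
        using I_ideal_triangle[of j n i a m] i j a
        by (simp add: edge_var_def insert_commute left_diff_distrib)
    qed
  qed
  from ideal_mult[OF ideal_I_ideal Q this] show ?thesis
    unfolding star a_def[symmetric] by (simp add: ac_simps)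
qed

lemma slide_both_ends:
  assumes i: "i \<in> {1..n}" and j: "j \<in> {1..n}"
  shows "edge_var i j * star_poly n r - edge_var (root_of r i) (root_of r j) * star_poly n r \<in> I_ideal n m"
proof -
  have "(edge_var i j - edge_var (root_of r i) j) * star_poly n r
      + (edge_var j (root_of r i) - edge_var (root_of r j) (root_of r i)) * star_poly n r \<in> I_ideal n m"
    by (intro ideal_add[OF ideal_I_ideal] slide_one_end i j root_in_vertices)
  then show ?thesis
    by (simp add: edge_var_commute[of j] edge_var_commute[of "root_of r j"] algebra_simps)
qed

text \<open>Both ends slide to the same root, where the edge becomes a loop.\<close>

lemma edge_inside_class:
  assumes "(i, j) \<in> r"
  shows "edge_var i j * star_poly n r \<in> I_ideal n m"
proof -
  have ij: "i \<in> {1..n}" "j \<in> {1..n}" using equiv_rules(3,4)[OF r assms] .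
  then have "root_of r i = root_of r j"
    using assms root_eq_iff[OF finite_atLeastAtMost r] by blast
  then show ?thesis
    using slide_both_ends[OF ij] by (simp add: edge_var_def[of "root_of r j" "root_of r j"])
qed

text \<open>Once the edge has been moved to the two roots \<open>a\<close> and \<open>b\<close> with \<open>a < b\<close>, triangle
  relations with this edge as the common side turn each edge that ends in \<open>b\<close> into one that ends
  in \<open>a\<close>; the outcome is the star monomial of the fused relation.\<close>

lemma edge_between_classes:
  assumes ij: "i \<in> {1..n}" "j \<in> {1..n}" "(i, j) \<notin> r"
  shows "edge_var i j * star_poly n r - star_poly n (merge r i j) \<in> I_ideal n m"
proof -
  let ?r' = "merge r i j" and ?N = "nonroots {1..n} r"
  define a where "a = min (root_of r i) (root_of r j)"
  define b where "b = max (root_of r i) (root_of r j)"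
  note root_merge' = root_merge[OF finite_atLeastAtMost r ij]
  note nonroots_merge' = nonroots_merge[OF finite_atLeastAtMost r ij, folded b_def]
  have ne: "root_of r i \<noteq> root_of r j"
    using ij root_eq_iff[OF finite_atLeastAtMost r] by blast
  have ab: "a \<in> {1..n}" "b \<in> {1..n}" "a \<noteq> b" "root_of r a = a" "root_of r b = b"
    using ij ne by (auto simp: a_def b_def min_def max_def root_in_vertices root_root[OF finite_atLeastAtMost r]
        simp del: atLeastAtMost_iff)
  have ev: "edge_var (root_of r i) (root_of r j) = edge_var b a"
    by (auto simp: a_def b_def min_def max_def edge_var_commute)
  have "root_of ?r' b = a"
    using ab root_merge'[of b] by (auto simp: a_def b_def max_def)
  then have star': "star_poly n ?r' = edge_var b a * (\<Prod>x\<in>?N. edge_var x (root_of ?r' x))"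
    unfolding star_poly_def nonroots_merge'(2)
    using nonroots_merge'(1) finite_nonroots[OF finite_atLeastAtMost r] by simp
  have "edge_var b a * ((\<Prod>x\<in>?N. edge_var x (root_of r x)) - (\<Prod>x\<in>?N. edge_var x (root_of ?r' x)))
      \<in> I_ideal n m"
  proof (rule prod_congruence[OF ideal_I_ideal finite_nonroots[OF finite_atLeastAtMost r]])
    fix x assume x: "x \<in> ?N"
    then have xV: "x \<in> {1..n}" and xr: "root_of r x \<noteq> x" by (simp_all add: nonroots_def)
    show "edge_var x (root_of r x) \<in> polys n"
      using xV by (simp add: root_in_vertices del: atLeastAtMost_iff)
    have r': "root_of ?r' x = (if root_of r x = b then a else root_of r x)"
      using root_merge'[OF xV] by (auto simp: a_def b_def min_def max_def)
    then show "edge_var x (root_of ?r' x) \<in> polys n"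
      using xV ab by (simp add: root_in_vertices del: atLeastAtMost_iff)
    show "edge_var b a * (edge_var x (root_of r x) - edge_var x (root_of ?r' x)) \<in> I_ideal n m"
    proof (cases "root_of r x = b")
      case True
      have "x \<noteq> b" "x \<noteq> a" using xr ab by auto
      then show ?thesis
        using True I_ideal_triangle[of x n b a m] xV ab
        by (simp add: r' edge_var_def algebra_simps)
    next
      case False
      then show ?thesis by (simp add: r' ideal_zero[OF ideal_I_ideal])
    qed
  qed
  then have "edge_var b a * star_poly n r - star_poly n ?r' \<in> I_ideal n m"
    unfolding star' by (simp add: star_poly_def[of n r] right_diff_distrib)
  from ideal_add[OF ideal_I_ideal slide_both_ends[OF ij(1,2)] this] show ?thesis
    by (simp add: ev)
qed

text \<open>The star of a class with more than \<open>m\<close> elements contains a star on exactly \<open>m + 1\<close>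
  vertices, and that is a tree.\<close>

lemma star_poly_large_class:
  assumes x: "x \<in> {1..n}" and large: "card (r `` {x}) > m"
  shows "star_poly n r \<in> I_ideal n m"
proof -
  define c where "c = root_of r x"
  let ?N = "nonroots {1..n} r" and ?u = "\<lambda>y. edge_var y (root_of r y)"
  have fin: "finite (r `` {x})" by (rule finite_class[OF finite_atLeastAtMost r])
  have "c \<in> r `` {x}" using root_rel[OF finite_atLeastAtMost r x] by (simp add: c_def)
  then have "m \<le> card (r `` {x} - {c})" using fin large by simp
  then obtain A where A: "A \<subseteq> r `` {x} - {c}" "card A = m"
    using obtain_subset_with_card_n by blast
  have finA: "finite A" using A(1) fin finite_subset by blast
  have rel: "(x, y) \<in> r" if "y \<in> A" for y
    using A(1) that by blast
  have V: "y \<in> {1..n}" if "y \<in> A" for y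
    by (rule equiv_rules(4)[OF r rel[OF that]])
  have root: "root_of r y = c" if "y \<in> A" for y
    using root_eq_iff[OF finite_atLeastAtMost r x V[OF that]] rel[OF that] by (simp add: c_def)
  have cA: "c \<notin> A" using A(1) by blast
  have "y \<in> ?N" if "y \<in> A" for y
    using V[OF that] root[OF that] cA that by (auto simp: nonroots_def)
  then have star: "star_poly n r = prod ?u (?N - A) * prod ?u A"
    unfolding star_poly_def
    by (intro prod.subset_diff finite_nonroots[OF finite_atLeastAtMost r] subsetI)
  have inj: "inj_on (\<lambda>y. {y, c}) A"
    by (rule inj_onI) (auto simp: doubleton_eq_iff)
  have "prod ?u A = (\<Prod>y\<in>A. var {y, c})"
    by (rule prod.cong) (use root cA in \<open>auto simp: edge_var_def\<close>)
  also have "\<dots> = graph_monomial ((\<lambda>y. {y, c}) ` A)"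
    by (simp add: graph_monomial_def prod.reindex[OF inj])
  also have "\<dots> \<in> I_ideal n m"
  proof (rule I_ideal_tree)
    show "insert c A \<subseteq> {1..n}"
      using V root_in_vertices[OF x] unfolding c_def by blast
    show "card (insert c A) = m + 1" using A(2) cA finA by simp
    show "tree (insert c A) ((\<lambda>y. {y, c}) ` A)"
      using star_tree[of "insert c A" c] finA cA by simp
  qed
  finally have "prod ?u A \<in> I_ideal n m" .
  moreover have "prod ?u (?N - A) \<in> polys n"
    by (rule polys_prod) (auto simp: nonroots_def root_in_vertices simp del: atLeastAtMost_iff)
  ultimately show ?thesis
    unfolding star by (rule ideal_mult[OF ideal_I_ideal, rotated])
qed

end

lemma star_poly_Id_on: "star_poly n (Id_on {1..n}) = 1"
  by (simp add: star_poly_def nonroots_Id_on)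

lemma equiv_Id_on: "equiv V (Id_on V)"
  using equiv_connection[of V "{}"] by (simp add: connection_empty)

text \<open>Building up the forest edge by edge, each new edge joins two classes of the relation
  reached so far.\<close>

lemma forest_monomial_star:
  assumes "forest {1..n} E"
  shows "graph_monomial E - star_poly n (connection {1..n} E) \<in> I_ideal n m"
proof -
  have "finite (pairs {1..n})" by (simp add: pairs_def)
  moreover have "E \<subseteq> pairs {1..n}" using assms by (simp add: forest_def simple_graph_def)
  ultimately have "finite E" using finite_subset by blast
  then show ?thesis using assms
  proof (induction E rule: finite_induct)
    case empty
    then show ?case
      by (simp add: connection_empty star_poly_Id_on graph_monomial_def ideal_zero[OF ideal_I_ideal])
  next
    case (insert S E)
    have SE: "insert S E \<subseteq> pairs {1..n}" using insert.prems by (simp add: forest_def simple_graph_def)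
    then obtain i j where S: "S = {i, j}" "i \<in> {1..n}" "j \<in> {1..n}" "i \<noteq> j" by (auto elim!: pairsE)
    note F = forest_insertD[OF insert.prems[unfolded S(1)] insert.hyps(2)[unfolded S(1)] S(4)]
    let ?c = "connection {1..n} E"
    have "var S * (graph_monomial E - star_poly n ?c)
        + (edge_var i j * star_poly n ?c - star_poly n (merge ?c i j)) \<in> I_ideal n m"
      by (intro ideal_add[OF ideal_I_ideal] ideal_mult[OF ideal_I_ideal] insert.IH F
          edge_between_classes equiv_connection S var_polys) (use SE in auto)
    moreover have "connection {1..n} (insert S E) = merge ?c i j"
      unfolding S(1) using SE by (intro connection_insert S) auto
    moreover have "graph_monomial (insert S E) = var S * graph_monomial E"
      using insert.hyps by (simp add: graph_monomial_def)
    moreover have "edge_var i j = var S" using S by (simp add: edge_var_def)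
    ultimately show ?case by (simp add: algebra_simps)
  qed
qed

text \<open>Multiplying the star monomial of the trivial relation, which is \<open>1\<close>, by one variable at a
  time, each step yields zero or another star monomial.\<close>

lemma monomial_reduces_to_star:
  assumes "t \<in> mons n"
  shows "Poly_Mapping.single t 1 \<in> I_ideal n m \<or>
    (\<exists>r. equiv {1..n} r \<and> Poly_Mapping.single t 1 - star_poly n r \<in> I_ideal n m)"
  using assms
proof (induction "mon_degree t" arbitrary: t)
  case 0
  have "card (Poly_Mapping.keys t) = 0"
    using card_keys_le_mon_degree[of t] 0 by linarith
  then have "t = 0" by simp
  then have "Poly_Mapping.single t 1 - star_poly n (Id_on {1..n}) = 0"
    by (simp add: star_poly_Id_on)
  then have "Poly_Mapping.single t 1 - star_poly n (Id_on {1..n}) \<in> I_ideal n m"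
    using ideal_zero[OF ideal_I_ideal] by (simp only:)
  then show ?case using equiv_Id_on by blast
next
  case (Suc d)
  have "t \<noteq> 0" using Suc.hyps(2) by (auto simp: mon_degree_def)
  then obtain S where S: "S \<in> Poly_Mapping.keys t" using keys_eq_empty by blast
  define s where "s = t - Poly_Mapping.single S 1"
  have t: "t = Poly_Mapping.single S 1 + s"
    using S by (intro poly_mapping_eqI) (auto simp: s_def lookup_add lookup_minus lookup_single when_def in_keys_iff)
  have Sp: "S \<in> pairs {1..n}" using S Suc.prems by (auto simp: mons_def)
  then obtain i j where ij: "S = {i, j}" "i \<in> {1..n}" "j \<in> {1..n}" "i \<noteq> j" by (rule pairsE)
  have ev: "edge_var i j = var S" using ij by (simp add: edge_var_def)
  have step: "Poly_Mapping.single t 1 = var S * Poly_Mapping.single s 1"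
    by (simp add: t var_def mult_single)
  have "s \<in> mons n" "d = mon_degree s"
    using Suc.prems Suc.hyps(2) unfolding t mon_degree_add by (auto simp: mon_degree_def)
  from Suc.hyps(1)[OF this(2,1)] show ?case
  proof (elim disjE exE conjE)
    assume "Poly_Mapping.single s 1 \<in> I_ideal n m"
    then show ?thesis
      unfolding step using ideal_mult[OF ideal_I_ideal var_polys[OF Sp]] by blast
  next
    fix r assume r: "equiv {1..n} r" and "Poly_Mapping.single s 1 - star_poly n r \<in> I_ideal n m"
    then have red: "var S * Poly_Mapping.single s 1 - var S * star_poly n r \<in> I_ideal n m"
      using ideal_mult[OF ideal_I_ideal var_polys[OF Sp]] by (simp flip: right_diff_distrib)
    show ?thesis
    proof (cases "(i, j) \<in> r")
      case True
      from ideal_add[OF ideal_I_ideal red edge_inside_class[OF r True, unfolded ev]]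
      show ?thesis by (simp add: step)
    next
      case False
      from ideal_add[OF ideal_I_ideal red edge_between_classes[OF r ij(2,3) False, unfolded ev]]
      have "Poly_Mapping.single t 1 - star_poly n (merge r i j) \<in> I_ideal n m"
        by (simp add: step)
      then show ?thesis using equiv_merge[OF r] by blast
    qed
  qed
qed

section \<open>Set partitions as equivalence relations\<close>

lemma finite_set_partitions: "finite (set_partitions n m)"
proof (rule finite_subset)
  show "set_partitions n m \<subseteq> Pow (Pow {1..n})"
    by (auto simp: set_partitions_def partition_on_def)
qed simp

lemma quotient_in_set_partitions:
  assumes "equiv {1..n} r" "\<And>x. x \<in> {1..n} \<Longrightarrow> card (r `` {x}) \<le> m"
  shows "{1..n} // r \<in> set_partitions n m"
  using assms partition_on_quotient[OF assms(1)]
  by (auto simp: set_partitions_def elim!: quotientE)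

lemma
  assumes "\<pi> \<in> set_partitions n m"
  shows equiv_part_rel: "equiv {1..n} (part_rel \<pi>)"
    and quotient_part_rel: "{1..n} // part_rel \<pi> = \<pi>"
    and card_part_rel_class: "x \<in> {1..n} \<Longrightarrow> card (part_rel \<pi> `` {x}) \<le> m"
proof -
  have P: "partition_on {1..n} \<pi>" "\<And>B. B \<in> \<pi> \<Longrightarrow> card B \<le> m"
    using assms by (auto simp: set_partitions_def)
  show "equiv {1..n} (part_rel \<pi>)"
    unfolding part_rel_def by (rule equiv_partition_on[OF P(1)])
  show q: "{1..n} // part_rel \<pi> = \<pi>"
    unfolding part_rel_def by (rule partition_on_eq_quotient[OF P(1)])
  show "x \<in> {1..n} \<Longrightarrow> card (part_rel \<pi> `` {x}) \<le> m"
    using P(2) quotientI[of x "{1..n}" "part_rel \<pi>"] q by simp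
qed

text \<open>Thus the condition on the forests in the family says that each of them generates the
  equivalence relation of its partition.\<close>

lemma components_eq_partition:
  assumes "components {1..n} E = \<pi>"
  shows "connection {1..n} E = part_rel \<pi>"
  using part_rel_quotient[OF equiv_connection[of "{1..n}" E]] assms
  by (simp add: components_def)

lemma forest_monomials_span_mod_I_ideal:
  assumes F: "\<And>\<pi>. \<pi> \<in> set_partitions n m \<Longrightarrow> forest {1..n} (F \<pi>) \<and> components {1..n} (F \<pi>) = \<pi>"
    and f: "f \<in> polys n"
  shows "\<exists>c. f - (\<Sum>\<pi>\<in>set_partitions n m. const (c \<pi>) * graph_monomial (F \<pi>)) \<in> I_ideal n m"
proof -
  let ?P = "set_partitions n m" and ?I = "I_ideal n m"
  let ?span = "\<lambda>f. \<exists>c. f - (\<Sum>\<pi>\<in>?P. const (c \<pi>) * graph_monomial (F \<pi>)) \<in> ?I"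
  have const_add: "const (a + b) = const a + const b" for a b
    by (simp add: const_def single_add)
  have const_mult: "const (a * b) = const a * const b" for a b
    by (simp add: const_def mult_single)
  have zero: "?span f" if "f \<in> ?I" for f
    by (rule exI[of _ "\<lambda>_. 0"]) (use that in \<open>simp add: const_def\<close>)
  have add: "?span (f + g)" if "?span f" "?span g" for f g
  proof -
    from that obtain c d where
      "f - (\<Sum>\<pi>\<in>?P. const (c \<pi>) * graph_monomial (F \<pi>)) \<in> ?I"
      "g - (\<Sum>\<pi>\<in>?P. const (d \<pi>) * graph_monomial (F \<pi>)) \<in> ?I" by blast
    from ideal_add[OF ideal_I_ideal this] show ?thesis
      by (intro exI[of _ "\<lambda>\<pi>. c \<pi> + d \<pi>"])
         (simp add: const_add distrib_right sum.distrib algebra_simps)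
  qed
  have scale: "?span (const a * f)" if "?span f" for a f
  proof -
    from that obtain c where
      "f - (\<Sum>\<pi>\<in>?P. const (c \<pi>) * graph_monomial (F \<pi>)) \<in> ?I" by blast
    from ideal_mult[OF ideal_I_ideal polys_constants(3) this] show ?thesis
      by (intro exI[of _ "\<lambda>\<pi>. a * c \<pi>"])
         (simp add: const_mult sum_distrib_left mult.assoc right_diff_distrib)
  qed
  have mono: "?span (Poly_Mapping.single t 1)" if t: "t \<in> mons n" for t
    using monomial_reduces_to_star[OF t, of m]
  proof (elim disjE exE conjE)
    fix r assume r: "equiv {1..n} r" and red: "Poly_Mapping.single t 1 - star_poly n r \<in> ?I"
    show ?thesis
    proof (cases "\<exists>x\<in>{1..n}. card (r `` {x}) > m")
      case True
      then have "star_poly n r \<in> ?I" using star_poly_large_class[OF r] by blast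
      from ideal_add[OF ideal_I_ideal red this] show ?thesis by (intro zero) simp
    next
      case False
      define \<rho> where "\<rho> = {1..n} // r"
      have \<rho>: "\<rho> \<in> ?P" unfolding \<rho>_def
        by (rule quotient_in_set_partitions[OF r]) (use False in \<open>auto simp: not_less\<close>)
      have "connection {1..n} (F \<rho>) = r"
        using components_eq_partition[of n "F \<rho>" \<rho>] F[OF \<rho>] part_rel_quotient[OF r] by (simp add: \<rho>_def)
      then have "graph_monomial (F \<rho>) - star_poly n r \<in> ?I"
        using forest_monomial_star[of n "F \<rho>" m] F[OF \<rho>] by simp
      from ideal_diff[OF ideal_I_ideal red this]
      have "Poly_Mapping.single t 1 - graph_monomial (F \<rho>) \<in> ?I" by simp
      moreover have "(\<Sum>\<pi>\<in>?P. const (if \<pi> = \<rho> then 1 else 0) * graph_monomial (F \<pi>))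
          = (\<Sum>\<pi>\<in>?P. if \<pi> = \<rho> then graph_monomial (F \<pi>) else 0)"
        by (rule sum.cong) (auto simp: const_def)
      ultimately show ?thesis
        using \<rho> finite_set_partitions[of n m]
        by (intro exI[of _ "\<lambda>\<pi>. if \<pi> = \<rho> then 1 else 0"]) simp
    qed
  qed (rule zero)
  have "?span (\<Sum>t\<in>A. Poly_Mapping.single t (a t))" if "finite A" "A \<subseteq> mons n" for A a
    using that
  proof (induction A rule: finite_induct)
    case empty
    then show ?case using zero[OF ideal_zero[OF ideal_I_ideal]] by simp
  next
    case (insert t A)
    then have "?span (const (a t) * Poly_Mapping.single t 1 + (\<Sum>t\<in>A. Poly_Mapping.single t (a t)))"
      by (intro add scale mono) auto
    then show ?case using insert by (simp add: const_def mult_single)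
  qed
  from this[of "Poly_Mapping.keys f" "Poly_Mapping.lookup f"] show ?thesis
    using f by (simp only: polys_iff finite_keys simp_thms flip: sum_of_terms[of f])
qed

section \<open>Evaluation at partitions\<close>

lemma eval_diff: "eval_mpoly z (f - g) = eval_mpoly z f - eval_mpoly z g"
  by (simp add: eval_mpoly_lin_ext lin_ext_diff)

lemma eval_mult: "eval_mpoly z (f * g) = eval_mpoly z f * eval_mpoly z g"
  using lin_ext_scale[of "lin_ext (mon_val z) g" "mon_val z" f]
  by (simp add: eval_mpoly_lin_ext lin_ext_mult mon_val_add lin_ext_scale mult.commute)

lemma eval_var: "eval_mpoly z (var S) = z S"
  by (simp add: eval_mpoly_lin_ext var_def mon_val_def)

text \<open>Evaluating a monomial at a partition only records whether all its edges lie inside blocks,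
  that is, whether its components refine the partition.\<close>

lemma mon_val_partition_point:
  assumes t: "t \<in> mons n" and \<pi>: "\<pi> \<in> set_partitions n m"
  shows "mon_val (partition_point n \<pi>) t =
    (if connection {1..n} (Poly_Mapping.keys t) \<subseteq> part_rel \<pi> then 1 else 0)"
proof -
  let ?z = "partition_point n \<pi>"
  have E: "Poly_Mapping.keys t \<subseteq> pairs {1..n}" using t by (simp add: mons_def)
  have z: "?z {i, j} = (if (i, j) \<in> part_rel \<pi> then 1 else 0)" if "{i, j} \<in> Poly_Mapping.keys t" for i j
    using that E by (auto simp: partition_point_def part_rel_def)
  note conn = connection_subset_iff[OF E equiv_part_rel[OF \<pi>]]
  show ?thesis
  proof (cases "connection {1..n} (Poly_Mapping.keys t) \<subseteq> part_rel \<pi>")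
    case True
    have "?z S = 1" if S: "S \<in> Poly_Mapping.keys t" for S
    proof -
      obtain i j where "S = {i, j}" using S E by (meson pairsE subsetD)
      then show ?thesis using True conn z S by auto
    qed
    then have "mon_val ?z t = 1"
      unfolding mon_val_def by (intro prod.neutral) auto
    then show ?thesis using True by simp
  next
    case False
    then obtain i j where ij: "{i, j} \<in> Poly_Mapping.keys t" "(i, j) \<notin> part_rel \<pi>"
      using conn by blast
    then have "?z {i, j} ^ Poly_Mapping.lookup t {i, j} = 0"
      using z[OF ij(1)] by (auto simp: in_keys_iff zero_power)
    then have "mon_val ?z t = 0"
      unfolding mon_val_def using ij(1) by (intro prod_zero) auto
    then show ?thesis using False by simp
  qed
qed

section \<open>The explicit generators as top components\<close>

lemma gr_ideal_props:
  shows ideal_gr_ideal: "I \<subseteq> polys n \<Longrightarrow> ideal (gr_ideal n I) (poly_ring n)"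
    and top_component_in_gr_ideal: "I \<subseteq> polys n \<Longrightarrow> f \<in> I \<Longrightarrow> f \<noteq> 0 \<Longrightarrow> top_component f \<in> gr_ideal n I"
    and gr_ideal_minimal: "ideal J (poly_ring n) \<Longrightarrow> (\<And>f. f \<in> I \<Longrightarrow> f \<noteq> 0 \<Longrightarrow> top_component f \<in> J) \<Longrightarrow> gr_ideal n I \<subseteq> J"
proof -
  interpret cring "poly_ring n" by (rule cring_poly_ring)
  let ?G = "{top_component f | f. f \<in> I \<and> f \<noteq> 0}"
  have G: "?G \<subseteq> polys n" if "I \<subseteq> polys n"
    using that top_component_polys by blast
  show "I \<subseteq> polys n \<Longrightarrow> ideal (gr_ideal n I) (poly_ring n)"
    unfolding gr_ideal_def by (rule genideal_ideal[OF G])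
  show "I \<subseteq> polys n \<Longrightarrow> f \<in> I \<Longrightarrow> f \<noteq> 0 \<Longrightarrow> top_component f \<in> gr_ideal n I"
    unfolding gr_ideal_def using genideal_self[OF G] by blast
  show "ideal J (poly_ring n) \<Longrightarrow> (\<And>f. f \<in> I \<Longrightarrow> f \<noteq> 0 \<Longrightarrow> top_component f \<in> J) \<Longrightarrow> gr_ideal n I \<subseteq> J"
    unfolding gr_ideal_def by (rule genideal_minimal) auto
qed

lemma vanishing_ideal_polys: "vanishing_ideal n Z \<subseteq> polys n"
  by (auto simp: vanishing_ideal_def)

text \<open>The summand \<open>h\<close> is an arbitrary polynomial of lower degree, so it suffices to lift \<open>g\<close> to
  an element of the vanishing ideal.\<close>

lemma homogeneous_in_gr_ideal:
  assumes "g + h \<in> vanishing_ideal n Z"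
    and "\<And>t. t \<in> Poly_Mapping.keys g \<Longrightarrow> mon_degree t = d"
    and "\<And>t. t \<in> Poly_Mapping.keys h \<Longrightarrow> mon_degree t < d"
  shows "g \<in> gr_ideal n (vanishing_ideal n Z)"
proof (cases "g = 0")
  case True
  then show ?thesis
    using ideal_zero[OF ideal_gr_ideal[OF vanishing_ideal_polys]] by simp
next
  case False
  then have top: "top_component (g + h) = g"
    using assms by (intro top_component_homogeneous_plus_lower)
  have "g + h \<noteq> 0"
    using False top by (auto simp: top_component_def)
  then show ?thesis
    using top_component_in_gr_ideal[OF vanishing_ideal_polys assms(1)] top by simp
qed

lemma keys_var_mult_var:
  "Poly_Mapping.keys (var S * var T) = {Poly_Mapping.single S 1 + Poly_Mapping.single T 1}"
  by (simp add: var_def mult_single)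

lemma mon_degree_single [simp]: "mon_degree (Poly_Mapping.single S k) = k"
  by (simp add: mon_degree_def)

lemma tree_vertices_in_class:
  assumes T: "tree V E" and V: "V \<subseteq> {1..n}" and \<pi>: "\<pi> \<in> set_partitions n m"
    and E: "\<And>x y. {x, y} \<in> E \<Longrightarrow> (x, y) \<in> part_rel \<pi>"
  shows "card V \<le> m"
proof -
  have "V \<noteq> {}" and conn: "\<And>u v. u \<in> V \<Longrightarrow> v \<in> V \<Longrightarrow> (u, v) \<in> connection V E"
    using T by (auto simp: tree_def connected_graph_def)
  then obtain u where u: "u \<in> V" by blast
  note eqv = equiv_part_rel[OF \<pi>]
  have "v \<in> part_rel \<pi> `` {u}" if "v \<in> V" for v
  proof -
    have "(u, v) \<in> {(x, y). {x, y} \<in> E}\<^sup>*"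
      using conn[OF u that] by (simp add: connection_def)
    then have "(u, v) \<in> part_rel \<pi>"
    proof (induction rule: rtrancl_induct)
      case base
      show ?case using u V equiv_rules(5)[OF eqv] by blast
    next
      case (step y z)
      then show ?case using E[of y z] equiv_rules(2)[OF eqv, of u y z] by simp
    qed
    then show ?thesis by simp
  qed
  then have "card V \<le> card (part_rel \<pi> `` {u})"
    by (intro card_mono finite_class[OF finite_atLeastAtMost eqv] subsetI)
  also have "\<dots> \<le> m" using card_part_rel_class[OF \<pi>] u V by blast
  finally show ?thesis .
qed

lemma partition_point_edge:
  assumes "i \<in> {1..n}" "j \<in> {1..n}" "i \<noteq> j"
  shows "partition_point n \<pi> {i, j} = (if (i, j) \<in> part_rel \<pi> then 1 else 0)"
  using assms by (auto simp: partition_point_def part_rel_def pairs_doubleton_iff)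

text \<open>The coordinates of the points are \<open>0\<close> or \<open>1\<close>, so each variable satisfies \<open>x\<^sup>2 - x = 0\<close> on
  them.\<close>

lemma square_in_gr_ideal:
  assumes S: "S \<in> pairs {1..n}"
  shows "var S * var S \<in> gr_ideal n (vanishing_ideal n (partition_locus n m))"
proof (rule homogeneous_in_gr_ideal[where d = 2])
  obtain i j where ij: "S = {i, j}" "i \<in> {1..n}" "j \<in> {1..n}" "i \<noteq> j"
    using S by (rule pairsE)
  have "eval_mpoly (partition_point n \<pi>) (var S * var S + - var S) = 0" for \<pi>
    using partition_point_edge[OF ij(2-4), of \<pi>]
    by (simp add: ij(1) eval_diff eval_mult eval_var)
  moreover have "var S * var S + - var S \<in> polys n"
    by (intro polys_add polys_mult polys_uminus var_polys S)
  ultimately show "var S * var S + - var S \<in> vanishing_ideal n (partition_locus n m)"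
    by (auto simp: vanishing_ideal_def partition_locus_def)
  show "mon_degree t = 2" if "t \<in> Poly_Mapping.keys (var S * var S)" for t
    using that by (simp add: keys_var_mult_var mon_degree_add)
  show "mon_degree t < 2" if "t \<in> Poly_Mapping.keys (- var S)" for t
    using that by (simp add: in_keys_iff var_def lookup_single when_def split: if_splits)
qed

text \<open>By transitivity both products indicate that \<open>i\<close>, \<open>j\<close> and \<open>k\<close> share a block.\<close>

lemma triangle_in_gr_ideal:
  assumes V: "i \<in> {1..n}" "j \<in> {1..n}" "k \<in> {1..n}" and ne: "i \<noteq> j" "j \<noteq> k" "i \<noteq> k"
  shows "var {i, j} * var {j, k} - var {i, k} * var {j, k}
    \<in> gr_ideal n (vanishing_ideal n (partition_locus n m))" (is "?f \<in> _")
proof (rule homogeneous_in_gr_ideal[where d = 2 and h = 0])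
  have "eval_mpoly (partition_point n \<pi>) ?f = 0" if "\<pi> \<in> set_partitions n m" for \<pi>
  proof (cases "(j, k) \<in> part_rel \<pi>")
    case True
    note rules = equiv_rules(1,2)[OF equiv_part_rel[OF that]]
    have "(i, j) \<in> part_rel \<pi> \<longleftrightarrow> (i, k) \<in> part_rel \<pi>"
      by (rule iffI) (erule rules(2), rule True, erule rules(2), rule rules(1)[OF True])
    then show ?thesis
      by (simp only: eval_diff eval_mult eval_var partition_point_edge[OF V(1,2) ne(1)]
          partition_point_edge[OF V(1,3) ne(3)] diff_self)
  next
    case False
    then show ?thesis
      by (simp add: eval_diff eval_mult eval_var partition_point_edge[OF V(2,3) ne(2)])
  qed
  moreover have "?f \<in> polys n"
    using V ne by (intro polys_diff polys_mult var_polys) (simp_all only: pairs_doubleton_iff simp_thms)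
  ultimately show "?f + 0 \<in> vanishing_ideal n (partition_locus n m)"
    by (auto simp: vanishing_ideal_def partition_locus_def)
  show "mon_degree t = 2" if "t \<in> Poly_Mapping.keys ?f" for t
  proof -
    have "t \<in> Poly_Mapping.keys (var {i, j} * var {j, k}) \<union> Poly_Mapping.keys (var {i, k} * var {j, k})"
      by (rule subsetD[OF keys_diff that])
    then show ?thesis
      by (auto simp: keys_var_mult_var mon_degree_add)
  qed
qed simp

text \<open>A tree inside a block would force the block to have \<open>m + 1\<close> elements.\<close>

lemma tree_monomial_in_gr_ideal:
  assumes V: "V \<subseteq> {1..n}" "card V = m + 1" and T: "tree V E"
  shows "graph_monomial E \<in> gr_ideal n (vanishing_ideal n (partition_locus n m))"
proof (rule homogeneous_in_gr_ideal[where d = "card E" and h = 0])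
  have "E \<subseteq> pairs V" using T by (simp add: tree_def forest_def simple_graph_def)
  moreover have "pairs V \<subseteq> pairs {1..n}" using V(1) by (auto simp: pairs_def)
  ultimately have E: "E \<subseteq> pairs {1..n}" by blast
  then have finE: "finite E" by (rule finite_subset) (simp add: pairs_def)
  have mon: "edge_mon E \<in> mons n"
    using E by (simp add: mons_def keys_edge_mon[OF finE])
  have "eval_mpoly (partition_point n \<pi>) (graph_monomial E) = 0" if \<pi>: "\<pi> \<in> set_partitions n m" for \<pi>
  proof -
    have "\<not> card V \<le> m" using V(2) by simp
    then obtain x y where "{x, y} \<in> E" "(x, y) \<notin> part_rel \<pi>"
      using tree_vertices_in_class[OF T V(1) \<pi>] by blast
    then have "\<not> connection {1..n} E \<subseteq> part_rel \<pi>"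
      using edge_in_connection[OF E] by blast
    then show ?thesis
      using mon_val_partition_point[OF mon \<pi>]
      by (simp add: graph_monomial_edge_mon eval_mpoly_lin_ext keys_edge_mon[OF finE])
  qed
  then show "graph_monomial E + 0 \<in> vanishing_ideal n (partition_locus n m)"
    using graph_monomial_polys[OF E] by (auto simp: vanishing_ideal_def partition_locus_def)
  show "mon_degree t = card E" if "t \<in> Poly_Mapping.keys (graph_monomial E)" for t
    using that by (simp add: graph_monomial_edge_mon mon_degree_edge_mon[OF finE])
qed simp

lemma I_ideal_subset_gr_ideal:
  "I_ideal n m \<subseteq> gr_ideal n (vanishing_ideal n (partition_locus n m))"
proof (rule I_ideal_minimal[OF ideal_gr_ideal[OF vanishing_ideal_polys]], intro Un_least)
  let ?gr = "gr_ideal n (vanishing_ideal n (partition_locus n m))"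
  show "{var S ^ 2 | S. S \<in> pairs {1..n}} \<subseteq> ?gr"
    unfolding power2_eq_square by clarify (rule square_in_gr_ideal)
  show "{var {i, j} * var {j, k} - var {i, k} * var {j, k} | i j k.
      {i, j, k} \<subseteq> {1..n} \<and> i \<noteq> j \<and> j \<noteq> k \<and> i \<noteq> k} \<subseteq> ?gr"
    by (clarsimp simp del: atLeastAtMost_iff) (rule triangle_in_gr_ideal)
  show "{graph_monomial E | V E. V \<subseteq> {1..n} \<and> card V = m + 1 \<and> tree V E} \<subseteq> ?gr"
    by clarify (rule tree_monomial_in_gr_ideal)
qed

section \<open>Functionals that vanish on the associated graded ideal\<close>

abbreviation mon_rel :: "nat \<Rightarrow> mon \<Rightarrow> (nat \<times> nat) set" where
  "mon_rel n t \<equiv> connection {1..n} (Poly_Mapping.keys t)"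

text \<open>On the points the monomials of \<open>f\<close> that generate the same equivalence relation \<open>\<sigma>\<close> agree with
  one function, the indicator of the partitions above \<open>\<sigma>\<close>.  These indicators form a unitriangular
  system with respect to refinement, so the coefficients in each group add up to zero.  Refinements
  of a relation with classes of size at most \<open>m\<close> again have this property, which makes induction
  along refinement possible.  The shift by \<open>h\<close> accounts for multiples of \<open>f\<close>.\<close>

lemma class_sum_vanishes:
  assumes f: "f \<in> vanishing_ideal n (partition_locus n m)" and h: "h \<in> mons n"
    and \<rho>: "equiv {1..n} \<rho>" "\<And>x. x \<in> {1..n} \<Longrightarrow> card (\<rho> `` {x}) \<le> m"
  shows "lin_ext (\<lambda>t. if mon_rel n (h + t) = \<rho> then 1 else 0) f = 0"
proof -
  have fp: "\<And>t. t \<in> Poly_Mapping.keys f \<Longrightarrow> t \<in> mons n"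
    using f by (auto simp: vanishing_ideal_def polys_iff)
  have "\<rho> \<subseteq> {1..n} \<times> {1..n}" using \<rho>(1) by (rule equivE)
  then have "finite \<rho>" by (rule finite_subset) simp
  then show ?thesis using \<rho>
  proof (induction \<rho> rule: finite_psubset_induct)
    case (psubset \<rho>)
    \<comment> \<open>The proper refinements of \<open>\<rho>\<close> that occur; there are finitely many.\<close>
    let ?S = "{\<sigma> \<in> mon_rel n ` (+) h ` Poly_Mapping.keys f. \<sigma> \<subset> \<rho>}"
    define \<pi> where "\<pi> = {1..n} // \<rho>"
    have \<pi>: "\<pi> \<in> set_partitions n m"
      unfolding \<pi>_def by (rule quotient_in_set_partitions) (use psubset.prems in auto)
    have rel: "part_rel \<pi> = \<rho>" unfolding \<pi>_def by (rule part_rel_quotient[OF psubset.prems(1)])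
    have "0 = mon_val (partition_point n \<pi>) h * eval_mpoly (partition_point n \<pi>) f"
      using f \<pi> by (auto simp: vanishing_ideal_def partition_locus_def)
    also have "\<dots> = lin_ext (\<lambda>t. mon_val (partition_point n \<pi>) (h + t)) f"
      by (simp add: eval_mpoly_lin_ext mon_val_add lin_ext_scale)
    also have "\<dots> = lin_ext (\<lambda>t. if mon_rel n (h + t) \<subseteq> \<rho> then 1 else 0) f"
      by (rule lin_ext_cong)
         (use mon_val_partition_point[OF _ \<pi>] fp h rel in \<open>simp del: keys_add_mon\<close>)
    also have "\<dots> = lin_ext (\<lambda>t. (if mon_rel n (h + t) = \<rho> then 1 else 0) +
        (\<Sum>\<sigma>\<in>?S. if mon_rel n (h + t) = \<sigma> then 1 else 0)) f"
      by (rule lin_ext_cong) (auto simp del: keys_add_mon)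
    also have "\<dots> = lin_ext (\<lambda>t. if mon_rel n (h + t) = \<rho> then 1 else 0) f +
        (\<Sum>\<sigma>\<in>?S. lin_ext (\<lambda>t. if mon_rel n (h + t) = \<sigma> then 1 else 0) f)"
      unfolding lin_ext_def distrib_left sum.distrib sum_distrib_left
      by (subst sum.swap) (rule refl)
    also have "(\<Sum>\<sigma>\<in>?S. lin_ext (\<lambda>t. if mon_rel n (h + t) = \<sigma> then 1 else 0) f) = 0"
    proof (rule sum.neutral, rule ballI)
      fix \<sigma> assume \<sigma>: "\<sigma> \<in> ?S"
      show "lin_ext (\<lambda>t. if mon_rel n (h + t) = \<sigma> then 1 else 0) f = 0"
      proof (rule psubset.IH)
        show "\<sigma> \<subset> \<rho>" using \<sigma> by blast
        show "equiv {1..n} \<sigma>" using \<sigma> equiv_connection by blast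
        fix x assume x: "x \<in> {1..n}"
        have "card (\<sigma> `` {x}) \<le> card (\<rho> `` {x})"
          using \<sigma> by (intro card_mono finite_class[OF finite_atLeastAtMost psubset.prems(1)]) blast
        also have "\<dots> \<le> m" by (rule psubset.prems(2)[OF x])
        finally show "card (\<sigma> `` {x}) \<le> m" .
      qed
    qed
    finally show ?case by simp
  qed
qed

text \<open>Take \<open>h * f\<close> with \<open>f\<close> in the vanishing ideal and \<open>h\<close> a monomial.  If its degree is the rank
  of \<open>\<rho>\<close>, all its monomials that generate \<open>\<rho>\<close> sit in top degree, so the sum of their coefficients,
  which vanishes, depends on the top component only.  In any other degree the top component has no
  monomial that is counted.\<close>

lemma top_class_sum_vanishes:
  assumes g: "g \<in> gr_ideal n (vanishing_ideal n (partition_locus n m))" (is "_ \<in> gr_ideal n ?I")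
    and \<rho>: "equiv {1..n} \<rho>" "\<And>x. x \<in> {1..n} \<Longrightarrow> card (\<rho> `` {x}) \<le> m"
  shows "lin_ext (\<lambda>t. if mon_rel n t = \<rho> \<and> mon_degree t = rank {1..n} \<rho> then 1 else 0) g = 0"
proof -
  let ?w = "\<lambda>t. if mon_rel n t = \<rho> \<and> mon_degree t = rank {1..n} \<rho> then 1 else 0"
  let ?K = "{g \<in> polys n. \<forall>h\<in>mons n. lin_ext (\<lambda>s. ?w (h + s)) g = 0}"
  have "gr_ideal n ?I \<subseteq> ?K"
  proof (rule gr_ideal_minimal[OF ideal_translates_vanish])
    fix f assume f: "f \<in> ?I"
    then have fp: "f \<in> polys n" using vanishing_ideal_polys by blast
    have "lin_ext (\<lambda>s. ?w (h + s)) (top_component f) = 0" if h: "h \<in> mons n" for h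
    proof (cases "mon_degree h + total_degree f = rank {1..n} \<rho>")
      case False
      have "lin_ext (\<lambda>s. ?w (h + s)) (top_component f) = lin_ext (\<lambda>s. 0) (top_component f)"
        by (rule lin_ext_cong) (use False in \<open>auto simp: keys_top_component mon_degree_add\<close>)
      then show ?thesis by (simp add: lin_ext_def)
    next
      case True
      \<comment> \<open>A monomial of degree below the rank of \<open>\<rho>\<close> has too few edges to connect \<open>\<rho>\<close>.\<close>
      have deg: "mon_degree t = total_degree f"
        if t: "t \<in> Poly_Mapping.keys f" and rel: "mon_rel n (h + t) = \<rho>" for t
      proof -
        have "h + t \<in> mons n" using t h fp by (auto simp: polys_iff)
        then have "rank {1..n} \<rho> \<le> card (Poly_Mapping.keys (h + t))"
          unfolding rel[symmetric] by (intro rank_connection(1)) (simp_all add: mons_def)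
        also have "\<dots> \<le> mon_degree h + mon_degree t"
          unfolding mon_degree_add[symmetric] by (rule card_keys_le_mon_degree)
        finally show ?thesis
          using True mon_degree_le_total_degree[OF t] by linarith
      qed
      have "lin_ext (\<lambda>s. ?w (h + s)) (top_component f) =
          (\<Sum>t\<in>Poly_Mapping.keys f. Poly_Mapping.lookup (top_component f) t * ?w (h + t))"
        by (rule lin_ext_superset) (auto simp: keys_top_component)
      also have "\<dots> = lin_ext (\<lambda>t. if mon_rel n (h + t) = \<rho> then 1 else 0) f"
        unfolding lin_ext_def
        by (rule sum.cong)
           (use True deg in \<open>auto simp: lookup_top_component mon_degree_add simp del: keys_add_mon\<close>)
      also have "\<dots> = 0" by (rule class_sum_vanishes[OF f h \<rho>])
      finally show ?thesis .
    qed
    then show "top_component f \<in> ?K" using top_component_polys[OF fp] by blast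
  qed
  with g have "\<forall>h\<in>mons n. lin_ext (\<lambda>s. ?w (h + s)) g = 0" by blast
  from bspec[OF this, of 0] show ?thesis by simp
qed

text \<open>The functionals of the preceding lemma form a dual family: a forest has exactly as many
  edges as the rank of the relation it generates, so its monomial is counted by the functional of
  its own partition and by no other.\<close>

lemma forest_monomials_independent_mod_gr_ideal:
  assumes F: "\<And>\<pi>. \<pi> \<in> set_partitions n m \<Longrightarrow> forest {1..n} (F \<pi>) \<and> components {1..n} (F \<pi>) = \<pi>"
    and g: "(\<Sum>\<pi>\<in>set_partitions n m. const (c \<pi>) * graph_monomial (F \<pi>))
      \<in> gr_ideal n (vanishing_ideal n (partition_locus n m))"
    and \<rho>: "\<rho> \<in> set_partitions n m"
  shows "c \<rho> = 0"
proof -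
  let ?P = "set_partitions n m" and ?r = "part_rel \<rho>"
  define w :: "mon \<Rightarrow> complex"
    where "w t = (if mon_rel n t = ?r \<and> mon_degree t = rank {1..n} ?r then 1 else 0)" for t
  have w: "w (edge_mon (F \<pi>)) = (if \<pi> = \<rho> then 1 else 0)" if \<pi>: "\<pi> \<in> ?P" for \<pi>
  proof -
    have "finite (pairs {1..n})" by (simp add: pairs_def)
    moreover have E: "F \<pi> \<subseteq> pairs {1..n}"
      using F[OF \<pi>] by (simp add: forest_def simple_graph_def)
    ultimately have fin: "finite (F \<pi>)" using finite_subset by blast
    have conn: "connection {1..n} (F \<pi>) = part_rel \<pi>"
      using components_eq_partition F[OF \<pi>] by blast
    have "rank {1..n} (part_rel \<pi>) = card (F \<pi>)"
      using rank_connection(2)[OF finite_atLeastAtMost E] F[OF \<pi>] conn by simp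
    moreover have "part_rel \<pi> = part_rel \<rho> \<longleftrightarrow> \<pi> = \<rho>"
      using quotient_part_rel[OF \<pi>] quotient_part_rel[OF \<rho>] by metis
    ultimately show ?thesis
      by (auto simp: w_def keys_edge_mon[OF fin] mon_degree_edge_mon[OF fin] conn)
  qed
  have "lin_ext w (\<Sum>\<pi>\<in>?P. const (c \<pi>) * graph_monomial (F \<pi>))
      = (\<Sum>\<pi>\<in>?P. if \<pi> = \<rho> then c \<pi> else 0)"
    unfolding lin_ext_sum
    by (intro sum.cong) (simp_all add: const_def graph_monomial_edge_mon mult_single w)
  moreover have "lin_ext w (\<Sum>\<pi>\<in>?P. const (c \<pi>) * graph_monomial (F \<pi>)) = 0"
    unfolding w_def
    by (rule top_class_sum_vanishes[OF g equiv_part_rel[OF \<rho>] card_part_rel_class[OF \<rho>]])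
  ultimately show ?thesis
    using \<rho> finite_set_partitions by simp
qed

section \<open>Bases of quotient algebras\<close>

lemma quotient_algebra_simps:
  fixes n I
  defines "R \<equiv> poly_ring n" and "M \<equiv> quotient_algebra n I"
  shows "carrier M = carrier (R Quot I)" "zero M = zero (R Quot I)" "add M = add (R Quot I)"
    "smult M c X = mult (R Quot I) (coset n I (const c)) X"
  by (simp_all add: M_def R_def quotient_algebra_def ring.defs FactRing_def coset_def)

context
  fixes n I assumes I: "ideal I (poly_ring n)"
begin

interpretation ideal I "poly_ring n" by (rule I)

lemma abelian_group_quotient_algebra: "abelian_group (quotient_algebra n I)"
proof -
  interpret Q: ring "poly_ring n Quot I" by (rule quotient_is_ring)
  have inverse: "\<exists>y\<in>carrier (poly_ring n Quot I). y \<oplus>\<^bsub>poly_ring n Quot I\<^esub> x = \<zero>\<^bsub>poly_ring n Quot I\<^esub>"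
    if "x \<in> carrier (poly_ring n Quot I)" for x
    using Q.a_inv_closed[OF that] Q.l_neg[OF that] by blast
  show ?thesis
    by (rule abelian_groupI)
       (simp_all add: quotient_algebra_simps Q.a_ac inverse)
qed

lemma carrier_quotient_algebra: "carrier (quotient_algebra n I) = coset n I ` polys n"
  by (simp only: quotient_algebra_simps FactRing_def A_RCOSETS_def' partial_object.simps)
     (auto simp: coset_def)

lemma coset_in_carrier: "f \<in> polys n \<Longrightarrow> coset n I f \<in> carrier (quotient_algebra n I)"
  by (simp add: carrier_quotient_algebra)

lemma add_coset: "f \<in> polys n \<Longrightarrow> g \<in> polys n \<Longrightarrow>
    add (quotient_algebra n I) (coset n I f) (coset n I g) = coset n I (f + g)"
  using a_rcos_sum[of f g] by (simp add: quotient_algebra_simps FactRing_def coset_def)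

lemma smult_coset: "f \<in> polys n \<Longrightarrow>
    smult (quotient_algebra n I) c (coset n I f) = coset n I (const c * f)"
  using rcoset_mult_add[of "const c" f]
  by (simp add: quotient_algebra_simps FactRing_def coset_def)

lemma coset_eq_iff: "f \<in> polys n \<Longrightarrow> g \<in> polys n \<Longrightarrow> coset n I f = coset n I g \<longleftrightarrow> f - g \<in> I"
proof -
  assume fg: "f \<in> polys n" "g \<in> polys n"
  have "a_inv (poly_ring n) g = - g" using fg minus_equality[of "- g" g] by simp
  then have "a_minus (poly_ring n) f g = f - g" by (simp add: a_minus_def)
  then show ?thesis
    using quotient_eq_iff_same_a_r_cos[OF I, of f g] fg by (simp add: coset_def)
qed

lemma coset_eq_zero_iff: "f \<in> polys n \<Longrightarrow> coset n I f = zero (quotient_algebra n I) \<longleftrightarrow> f \<in> I"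
proof -
  assume f: "f \<in> polys n"
  have "coset n I 0 = I"
    using a_coset_add_zero[of I] a_subset by (simp add: coset_def)
  then show ?thesis
    using coset_eq_iff[OF f, of 0] by (simp add: quotient_algebra_simps FactRing_def)
qed

lemma finsum_coset:
  assumes "finite A" "\<And>i. i \<in> A \<Longrightarrow> b i \<in> polys n"
  shows "finsum (quotient_algebra n I) (\<lambda>i. smult (quotient_algebra n I) (c i) (coset n I (b i))) A
    = coset n I (\<Sum>i\<in>A. const (c i) * b i)"
  using assms
proof (induction A rule: finite_induct)
  interpret M: abelian_group "quotient_algebra n I" by (rule abelian_group_quotient_algebra)
  case empty
  then show ?case
    using coset_eq_zero_iff[of 0] ideal_zero[OF I] by simp
next
  interpret M: abelian_group "quotient_algebra n I" by (rule abelian_group_quotient_algebra)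
  case (insert i A)
  then show ?case
    by (subst M.finsum_insert)
       (auto simp: smult_coset coset_in_carrier add_coset Pi_iff)
qed

text \<open>The basis property of a family of classes, restated through congruences between
  polynomials.\<close>

lemma finite_basis_familyI:
  assumes "finite A" and b: "\<And>i. i \<in> A \<Longrightarrow> b i \<in> polys n"
    and indep: "\<And>c i. (\<Sum>i\<in>A. const (c i) * b i) \<in> I \<Longrightarrow> i \<in> A \<Longrightarrow> c i = 0"
    and span: "\<And>f. f \<in> polys n \<Longrightarrow> \<exists>c. f - (\<Sum>i\<in>A. const (c i) * b i) \<in> I"
  shows "finite_basis_family (quotient_algebra n I) A (\<lambda>i. coset n I (b i))"
proof -
  have comb: "(\<Sum>i\<in>A. const (c i) * b i) \<in> polys n" for c
    by (rule polys_sum) (simp add: b)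
  have fs: "finsum (quotient_algebra n I) (\<lambda>i. smult (quotient_algebra n I) (c i) (coset n I (b i))) A
      = coset n I (\<Sum>i\<in>A. const (c i) * b i)" for c
    by (rule finsum_coset[OF assms(1) b])
  show ?thesis
    unfolding finite_basis_family_def
  proof (intro conjI)
    show "lin_indep_family (quotient_algebra n I) A (\<lambda>i. coset n I (b i))"
      unfolding lin_indep_family_def fs coset_eq_zero_iff[OF comb] using indep by blast
    show "spanning_family (quotient_algebra n I) A (\<lambda>i. coset n I (b i))"
      unfolding spanning_family_def fs
    proof
      fix v assume "v \<in> carrier (quotient_algebra n I)"
      then obtain f where f: "f \<in> polys n" "v = coset n I f"
        unfolding carrier_quotient_algebra by blast
      with span[OF f(1)] show "\<exists>c. v = coset n I (\<Sum>i\<in>A. const (c i) * b i)"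
        using coset_eq_iff[OF f(1) comb] by blast
    qed
  qed (use assms(1) b coset_in_carrier in auto)
qed

end

section \<open>The two ideals and the basis\<close>

text \<open>An element of the larger ideal is congruent, modulo the smaller one, to a combination of
  forest monomials.  That combination lies in the larger ideal too, and independence makes all its
  coefficients zero.\<close>

lemma gr_ideal_subset_I_ideal:
  "gr_ideal n (vanishing_ideal n (partition_locus n m)) \<subseteq> I_ideal n m" (is "?gr \<subseteq> _")
proof
  fix f assume f: "f \<in> ?gr"
  note gr = ideal_gr_ideal[OF vanishing_ideal_polys[of n "partition_locus n m"]]
  define F where "F = (\<lambda>\<pi> :: nat set set. SOME E. forest {1..n} E \<and> components {1..n} E = \<pi>)"
  have F: "forest {1..n} (F \<pi>) \<and> components {1..n} (F \<pi>) = \<pi>" if \<pi>: "\<pi> \<in> set_partitions n m" for \<pi>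
  proof -
    obtain E where "forest {1..n} E" "connection {1..n} E = part_rel \<pi>"
      using star_forest_exists[OF finite_atLeastAtMost equiv_part_rel[OF \<pi>]] .
    then have "forest {1..n} E \<and> components {1..n} E = \<pi>"
      using quotient_part_rel[OF \<pi>] by (simp add: components_def)
    then show ?thesis unfolding F_def by (rule someI)
  qed
  obtain c where c: "f - (\<Sum>\<pi>\<in>set_partitions n m. const (c \<pi>) * graph_monomial (F \<pi>)) \<in> I_ideal n m"
    using forest_monomials_span_mod_I_ideal[OF F ideal_polys[OF gr f]] by blast
  from ideal_diff[OF gr f subsetD[OF I_ideal_subset_gr_ideal c]]
  have "(\<Sum>\<pi>\<in>set_partitions n m. const (c \<pi>) * graph_monomial (F \<pi>)) \<in> ?gr" by simp
  then have "c \<pi> = 0" if "\<pi> \<in> set_partitions n m" for \<pi>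
    using forest_monomials_independent_mod_gr_ideal[OF F] that by blast
  then show "f \<in> I_ideal n m" using c by (simp add: const_def)
qed

theorem corollary3p26:
  fixes n m :: nat
  assumes "m \<le> n"
  shows "(\<forall>F :: nat set set \<Rightarrow> nat set set.
            (\<forall>\<pi>\<in>set_partitions n m. forest {1..n} (F \<pi>) \<and> components {1..n} (F \<pi>) = \<pi>) \<longrightarrow>
            finite_basis_family (orbit_harmonics n (partition_locus n m)) (set_partitions n m)
              (\<lambda>\<pi>. coset n (gr_ideal n (vanishing_ideal n (partition_locus n m)))
                      (graph_monomial (F \<pi>)))) \<and>
         gr_ideal n (vanishing_ideal n (partition_locus n m)) = I_ideal n m"
proof (intro conjI allI impI)
  fix F :: "nat set set \<Rightarrow> nat set set"
  assume "\<forall>\<pi>\<in>set_partitions n m. forest {1..n} (F \<pi>) \<and> components {1..n} (F \<pi>) = \<pi>"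
  then have F: "\<And>\<pi>. \<pi> \<in> set_partitions n m \<Longrightarrow>
      forest {1..n} (F \<pi>) \<and> components {1..n} (F \<pi>) = \<pi>" by blast
  let ?gr = "gr_ideal n (vanishing_ideal n (partition_locus n m))"
  show "finite_basis_family (orbit_harmonics n (partition_locus n m)) (set_partitions n m)
      (\<lambda>\<pi>. coset n ?gr (graph_monomial (F \<pi>)))"
    unfolding orbit_harmonics_def
  proof (rule finite_basis_familyI[OF ideal_gr_ideal[OF vanishing_ideal_polys] finite_set_partitions])
    show "graph_monomial (F \<pi>) \<in> polys n" if "\<pi> \<in> set_partitions n m" for \<pi>
      using F[OF that] by (intro graph_monomial_polys) (simp add: forest_def simple_graph_def)
    show "c \<pi> = 0" if "(\<Sum>\<pi>\<in>set_partitions n m. const (c \<pi>) * graph_monomial (F \<pi>)) \<in> ?gr"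
      "\<pi> \<in> set_partitions n m" for c \<pi>
      by (rule forest_monomials_independent_mod_gr_ideal[OF F that])
    show "\<exists>c. f - (\<Sum>\<pi>\<in>set_partitions n m. const (c \<pi>) * graph_monomial (F \<pi>)) \<in> ?gr"
      if "f \<in> polys n" for f
      using forest_monomials_span_mod_I_ideal[OF F that] I_ideal_subset_gr_ideal by blast
  qed
qed (intro equalityI gr_ideal_subset_I_ideal I_ideal_subset_gr_ideal)

end
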